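(* Let $n\ge 1$, $N=2n$, let $V$ be an irreducible module over the symplectic Lie algebra $\mathfrak{sp}_N$ (over $\mathbb{C}$, possibly infinite-dimensional), and let $\alpha,\beta\in\mathbb{C}^N$. Then the $\mathfrak{H}_N$-module $F^{\alpha,\beta}(V)$ is irreducible if and only if one of the following conditions holds: \begin{itemize} \item[(i)] $\dim V=\infty$; \item[(ii)] $\dim V<\infty$ and $V\not\cong V(\delta_k)$ for all $0\le k\le n$; \item[(iii)] $V\cong\mathbb{C}$ (the one-dimensional trivial module) and $\alpha\notin\mathbb{Z}^N$. \end{itemize}
   Context: All vector spaces and Lie algebras are over $\mathbb{C}$; $N=2n$ with $n\ge 1$. Elements of $\mathbb{C}^N$ are viewed as column vectors, $(u,v)=\sum_{i=1}^N u_iv_i$ is the standard bilinear form on $\mathbb{C}^N$, and $e_{i,j}$ are the standard matrix units of $\mathfrak{gl}_N$. Symplectic Lie algebra: $\mathfrak{sp}_N\subset\mathfrak{gl}_N$ is the Lie subalgebra spanned by $h_i=e_{i,i}-e_{n+i,n+i}$ ($1\le i\le n$), $X_{\epsilon_i-\epsilon_j}=e_{i,j}-e_{n+j,n+i}$ ($1\le i\ne j\le n$), $X_{\epsilon_k+\epsilon_l}=e_{k,n+l}+e_{l,n+k}$ and $X_{-\epsilon_k-\epsilon_l}=e_{n+k,l}+e_{n+l,k}$ ($1\le k\le l\le n$). Its Cartan subalgebra is $\mathfrak{h}=\mathrm{span}_{\mathbb{C}}\{h_1,\dots,h_n\}$, and $\epsilon_i\in\mathfrak{h}^*$ is given by $\epsilon_i(h_j)=\delta_{i,j}$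 (Kronecker delta). The simple roots are $\epsilon_1-\epsilon_2,\dots,\epsilon_{n-1}-\epsilon_n,2\epsilon_n$, with coroots $\alpha_i^\vee=h_i-h_{i+1}$ for $1\le i\le n-1$ and $\alpha_n^\vee=h_n$. The fundamental weights $\delta_1,\dots,\delta_n\in\mathfrak{h}^*$ are defined by $\delta_i(\alpha_j^\vee)=\delta_{i,j}$ (Kronecker delta on the right-hand side), and $\delta_0=0$. For $0\le k\le n$, $V(\delta_k)$ denotes the irreducible finite-dimensional $\mathfrak{sp}_N$-module with highest weight $\delta_k$; in particular $V(\delta_0)\cong\mathbb{C}$ is the one-dimensional trivial module. Hamiltonian Lie algebra: Let $A_N=\mathbb{C}[t_1^{\pm1},\dots,t_N^{\pm1}]$, $t^r=t_1^{r_1}\cdots t_N^{r_N}$ for $r\in\mathbb{Z}^N$, and $d_i=t_i\frac{\partial}{\partial t_i}$ for $1\le i\le N$. For $u\in\mathbb{C}^N$, $r\in\mathbb{Z}^N$ put $D(u,r)=\sum_{i=1}^N u_it^rd_i\in W_N=\mathrm{Der}(A_N)$. For $r=(r_1,\dots,r_{2n})^t\in\mathbb{Z}^N$ put $\bar r=(r_{n+1},\dots,r_{2n},-r_1,\dots,-r_n)^t$ and $\mathbf{h}_r=D(\bar r,r)$ (so $\mathbf{h}_0=0$). The Hamiltonian Lie algebra is the Lie subalgebra of $W_N$ $$\mathfrak{H}_N=\mathrm{span}_{\mathbb{C}}\{\mathbf{h}_r: r\in\mathbb{Z}^N,\ r\ne0\}\oplus\bigoplus_{i=1}^N\mathbb{C}d_i,$$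 with brackets $[\mathbf{h}_r,\mathbf{h}_s]=(\bar r,s)\,\mathbf{h}_{r+s}$, $[d_i,\mathbf{h}_r]=r_i\mathbf{h}_r$, $[d_i,d_j]=0$. Shen-Larsson functor: For $r\in\mathbb{Z}^N$ the $N\times N$ matrix $r\bar r^{\,t}$ (column times row) belongs to $\mathfrak{sp}_N$. For $\alpha,\beta\in\mathbb{C}^N$ and an $\mathfrak{sp}_N$-module $V$, the $\mathfrak{H}_N$-module $F^{\alpha,\beta}(V)$ is the vector space $V\otimes A_N$ with action $$\mathbf{h}_r(v\otimes t^s)=\big((\bar r,s+\alpha)I+r\bar r^{\,t}\big)v\otimes t^{r+s},\qquad d_i(v\otimes t^s)=(s_i+\beta_i)\,v\otimes t^s,$$ for $v\in V$, $r,s\in\mathbb{Z}^N$, $1\le i\le N$, where $I$ is the identity operator on $V$ and $r\bar r^{\,t}\in\mathfrak{sp}_N$ acts on $v$ through the given $\mathfrak{sp}_N$-module structure of $V$. *)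

theory Defs
  imports "HOL-Analysis.Analysis" "HOL-Library.Poly_Mapping"
begin

section \<open>Modules over complex Lie algebras\<close>

text \<open>A complex Lie algebra is given by a set \<open>L\<close> of elements together with a scaling \<open>scaleL\<close> and
  a bracket \<open>br\<close> on the ambient type. Modules live on a whole type, with an explicit complex scaling,
  and may be infinite-dimensional. The operators \<open>act x\<close> are constrained only for \<open>x \<in> L\<close>.\<close>

locale lie_module = vector_space smul
  for L :: "'l::ab_group_add set"
    and scaleL :: "complex \<Rightarrow> 'l \<Rightarrow> 'l"
    and br :: "'l \<Rightarrow> 'l \<Rightarrow> 'l"
    and smul :: "complex \<Rightarrow> 'v::ab_group_add \<Rightarrow> 'v"
    and act :: "'l \<Rightarrow> 'v \<Rightarrow> 'v" +
  assumes act_add_right: "x \<in> L \<Longrightarrow> act x (v + w) = act x v + act x w"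
    and act_scale_right: "x \<in> L \<Longrightarrow> act x (smul c v) = smul c (act x v)"
    and act_add_left: "x \<in> L \<Longrightarrow> y \<in> L \<Longrightarrow> act (x + y) v = act x v + act y v"
    and act_scale_left: "x \<in> L \<Longrightarrow> act (scaleL c x) v = smul c (act x v)"
    and act_bracket: "x \<in> L \<Longrightarrow> y \<in> L \<Longrightarrow> act (br x y) v = act x (act y v) - act y (act x v)"
begin

definition submodule :: "'v set \<Rightarrow> bool" where
  "submodule U \<longleftrightarrow> subspace U \<and> (\<forall>x\<in>L. \<forall>v\<in>U. act x v \<in> U)"

end

locale irreducible_lie_module = lie_module L scaleL br smul act
  for L :: "'l::ab_group_add set" and scaleL br
    and smul :: "complex \<Rightarrow> 'v::ab_group_add \<Rightarrow> 'v" and act +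
  assumes nonzero: "\<exists>v::'v. v \<noteq> 0"
    and simple: "submodule U \<Longrightarrow> U = {0} \<or> U = UNIV"

definition lie_module_iso ::
  "'l set \<Rightarrow> (complex \<Rightarrow> 'v::ab_group_add \<Rightarrow> 'v) \<Rightarrow> ('l \<Rightarrow> 'v \<Rightarrow> 'v)
    \<Rightarrow> (complex \<Rightarrow> 'w::ab_group_add \<Rightarrow> 'w) \<Rightarrow> ('l \<Rightarrow> 'w \<Rightarrow> 'w) \<Rightarrow> bool" where
  "lie_module_iso L scale1 act1 scale2 act2 \<longleftrightarrow>
    (\<exists>\<phi>. Vector_Spaces.linear scale1 scale2 \<phi> \<and> bij \<phi> \<and>
         (\<forall>x\<in>L. \<forall>v. \<phi> (act1 x v) = act2 x (\<phi> v)))"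

definition finite_dim :: "(complex \<Rightarrow> 'v::ab_group_add \<Rightarrow> 'v) \<Rightarrow> bool" where
  "finite_dim smul \<longleftrightarrow> (\<exists>B. finite B \<and> module.span smul B = UNIV)"


section \<open>The symplectic Lie algebra\<close>

text \<open>The index set \<open>{1..n}\<close> is a finite linearly ordered type \<open>'n\<close>, so that \<open>n = CARD('n) \<ge> 1\<close>, and
  \<open>{1..2n}\<close> is \<open>'n + 'n\<close>: \<open>Inl i\<close> stands for \<open>i\<close> and \<open>Inr i\<close> for \<open>n + i\<close>.\<close>

type_synonym 'n cmat = "complex ^ ('n + 'n) ^ ('n + 'n)"

definition mat_scale :: "complex \<Rightarrow> complex ^ 'm ^ 'm \<Rightarrow> complex ^ 'm ^ 'm" where
  "mat_scale c A = (\<chi> i j. c * A $ i $ j)"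

definition mat_bracket :: "complex ^ 'm ^ 'm \<Rightarrow> complex ^ 'm ^ 'm \<Rightarrow> complex ^ 'm ^ 'm" where
  "mat_bracket A B = A ** B - B ** A"

definition E :: "'m \<Rightarrow> 'm \<Rightarrow> complex ^ 'm ^ 'm" where
  "E i j = (\<chi> a b. if a = i \<and> b = j then 1 else 0)"

definition sp_h :: "'n::finite \<Rightarrow> 'n cmat" where
  "sp_h i = E (Inl i) (Inl i) - E (Inr i) (Inr i)"

definition X_minus :: "'n::finite \<Rightarrow> 'n \<Rightarrow> 'n cmat" where  \<comment> \<open>root \<open>\<epsilon>\<^sub>i - \<epsilon>\<^sub>j\<close>\<close>
  "X_minus i j = E (Inl i) (Inl j) - E (Inr j) (Inr i)"

definition X_pos :: "'n::finite \<Rightarrow> 'n \<Rightarrow> 'n cmat" where  \<comment> \<open>root \<open>\<epsilon>\<^sub>k + \<epsilon>\<^sub>l\<close>\<close>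
  "X_pos k l = E (Inl k) (Inr l) + E (Inl l) (Inr k)"

definition X_neg :: "'n::finite \<Rightarrow> 'n \<Rightarrow> 'n cmat" where  \<comment> \<open>root \<open>- \<epsilon>\<^sub>k - \<epsilon>\<^sub>l\<close>\<close>
  "X_neg k l = E (Inr k) (Inl l) + E (Inr l) (Inl k)"

definition sp :: "('n::{finite,linorder}) cmat set" where
  "sp = module.span mat_scale
     (range sp_h \<union> {X_minus i j |i j. i \<noteq> j} \<union> {X_pos k l |k l. k \<le> l} \<union> {X_neg k l |k l. k \<le> l})"

definition cartan :: "('n::finite) cmat set" where
  "cartan = module.span mat_scale (range sp_h)"

definition position :: "'n::{finite,linorder} \<Rightarrow> nat" where
  "position i = card {..i}"

definition coroot :: "'n::{finite,linorder} \<Rightarrow> 'n cmat" where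
  "coroot i = (if i = Max UNIV then sp_h i else sp_h i - sp_h (Min {j. i < j}))"

text \<open>Elements of the dual of the Cartan subalgebra are represented by functions on all matrices, of
  which only the values on \<open>cartan\<close> are ever used.\<close>

definition is_weight :: "('n::finite cmat \<Rightarrow> complex) \<Rightarrow> bool" where
  "is_weight \<mu> \<longleftrightarrow>
    (\<forall>x\<in>cartan. \<forall>y\<in>cartan. \<mu> (x + y) = \<mu> x + \<mu> y) \<and>
    (\<forall>c. \<forall>x\<in>cartan. \<mu> (mat_scale c x) = c * \<mu> x)"

definition is_fundamental_weight :: "nat \<Rightarrow> ('n::{finite,linorder} cmat \<Rightarrow> complex) \<Rightarrow> bool" where
  "is_fundamental_weight k \<mu> \<longleftrightarrow> is_weight \<mu> \<and>
    (if k = 0 then \<forall>x\<in>cartan. \<mu> x = 0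
     else \<forall>j. \<mu> (coroot j) = (if position j = k then 1 else 0))"

text \<open>The positive roots for the simple roots \<open>\<epsilon>\<^sub>i - \<epsilon>\<^sub>i\<^sub>+\<^sub>1\<close>, \<open>2\<epsilon>\<^sub>n\<close> are \<open>\<epsilon>\<^sub>i - \<epsilon>\<^sub>j\<close> with \<open>i < j\<close> and
  \<open>\<epsilon>\<^sub>k + \<epsilon>\<^sub>l\<close> with \<open>k \<le> l\<close>.\<close>

definition highest_weight_vector ::
  "(complex \<Rightarrow> 'v::ab_group_add \<Rightarrow> 'v) \<Rightarrow> ('n::{finite,linorder} cmat \<Rightarrow> 'v \<Rightarrow> 'v)
    \<Rightarrow> ('n cmat \<Rightarrow> complex) \<Rightarrow> 'v \<Rightarrow> bool" where
  "highest_weight_vector smul act \<mu> v \<longleftrightarrow> v \<noteq> 0 \<and>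
    (\<forall>x\<in>cartan. act x v = smul (\<mu> x) v) \<and>
    (\<forall>i j. i < j \<longrightarrow> act (X_minus i j) v = 0) \<and>
    (\<forall>k l. k \<le> l \<longrightarrow> act (X_pos k l) v = 0)"

abbreviation irreducible_sp_module ::
  "(complex \<Rightarrow> 'v::ab_group_add \<Rightarrow> 'v) \<Rightarrow> ('n::{finite,linorder} cmat \<Rightarrow> 'v \<Rightarrow> 'v) \<Rightarrow> bool" where
  "irreducible_sp_module smul act \<equiv> irreducible_lie_module sp mat_scale mat_bracket smul act"

text \<open>\<open>V(\<delta>\<^sub>k)\<close> is by definition the irreducible finite-dimensional module of highest weight \<open>\<delta>\<^sub>k\<close>, which is
  determined only up to isomorphism. The predicate \<open>is_V_delta k\<close>, i.e. being such a module, is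
  therefore the relation \<open>V \<cong> V(\<delta>\<^sub>k)\<close>; see \<open>is_V_delta_iso\<close> for its invariance under isomorphism.\<close>

definition is_V_delta ::
  "nat \<Rightarrow> (complex \<Rightarrow> 'v::ab_group_add \<Rightarrow> 'v) \<Rightarrow> ('n::{finite,linorder} cmat \<Rightarrow> 'v \<Rightarrow> 'v) \<Rightarrow> bool" where
  "is_V_delta k smul act \<longleftrightarrow> irreducible_sp_module smul act \<and> finite_dim smul \<and>
    (\<exists>\<mu> v. is_fundamental_weight k \<mu> \<and> highest_weight_vector smul act \<mu> v)"

definition is_trivial_module ::
  "(complex \<Rightarrow> 'v::ab_group_add \<Rightarrow> 'v) \<Rightarrow> ('n::{finite,linorder} cmat \<Rightarrow> 'v \<Rightarrow> 'v) \<Rightarrow> bool" where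
  "is_trivial_module smul act \<longleftrightarrow>
    lie_module_iso sp smul act ((*) :: complex \<Rightarrow> complex \<Rightarrow> complex) (\<lambda>_ _. 0)"


section \<open>The Hamiltonian Lie algebra\<close>

definition pair :: "complex ^ 'm \<Rightarrow> complex ^ 'm \<Rightarrow> complex" where
  "pair u v = (\<Sum>i\<in>UNIV. u $ i * v $ i)"

definition cvec :: "int ^ 'm \<Rightarrow> complex ^ 'm" where
  "cvec r = (\<chi> i. of_int (r $ i))"

definition bar :: "int ^ ('n::finite + 'n) \<Rightarrow> int ^ ('n + 'n)" where
  "bar r = (\<chi> i. case i of Inl k \<Rightarrow> r $ Inr k | Inr k \<Rightarrow> - r $ Inl k)"

definition pm_scale :: "(complex \<Rightarrow> 'v \<Rightarrow> 'v) \<Rightarrow> complex \<Rightarrow> ('k \<Rightarrow>\<^sub>0 'v::ab_group_add) \<Rightarrow> ('k \<Rightarrow>\<^sub>0 'v)" where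
  "pm_scale smul c = Poly_Mapping.map (smul c)"

text \<open>\<open>W\<^sub>N\<close> is the free \<open>A\<^sub>N\<close>-module on the \<open>d\<^sub>i\<close>. Its elements, the finite sums of \<open>D(u, r)\<close>, are
  represented as finitely supported functions \<open>\<int>\<^sup>N \<Rightarrow> \<complex>\<^sup>N\<close>, with \<open>D(u, r)\<close> being \<open>D u r\<close> below.\<close>

type_synonym 'm witt = "(int ^ 'm) \<Rightarrow>\<^sub>0 (complex ^ 'm)"

abbreviation witt_scale :: "complex \<Rightarrow> 'm::finite witt \<Rightarrow> 'm witt" where
  "witt_scale \<equiv> pm_scale (*s)"

definition D :: "complex ^ 'm \<Rightarrow> int ^ 'm \<Rightarrow> 'm::finite witt" where
  "D u r = Poly_Mapping.single r u"

text \<open>The derivation of the Laurent polynomials \<open>A\<^sub>N\<close> (finitely supported functions \<open>\<int>\<^sup>N \<Rightarrow> \<complex>\<close>)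
  given by an element of \<open>W\<^sub>N\<close>: \<open>D(u, r) t\<^sup>s = (u, s) t\<^sup>r\<^sup>+\<^sup>s\<close>.\<close>

definition witt_apply :: "'m::finite witt \<Rightarrow> (int ^ 'm \<Rightarrow>\<^sub>0 complex) \<Rightarrow> (int ^ 'm \<Rightarrow>\<^sub>0 complex)" where
  "witt_apply x f = (\<Sum>r\<in>Poly_Mapping.keys x. \<Sum>s\<in>Poly_Mapping.keys f.
     Poly_Mapping.single (r + s) (pair (Poly_Mapping.lookup x r) (cvec s) * Poly_Mapping.lookup f s))"

text \<open>The commutator of derivations: \<open>[D(u, r), D(v, s)] = D((u, s) v - (v, r) u, r + s)\<close>.\<close>

definition witt_bracket :: "'m::finite witt \<Rightarrow> 'm witt \<Rightarrow> 'm witt" where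
  "witt_bracket x y = (\<Sum>r\<in>Poly_Mapping.keys x. \<Sum>s\<in>Poly_Mapping.keys y.
     (let u = Poly_Mapping.lookup x r; v = Poly_Mapping.lookup y s
      in D (pair u (cvec s) *s v - pair v (cvec r) *s u) (r + s)))"

definition ham_h :: "int ^ ('n::finite + 'n) \<Rightarrow> ('n::finite + 'n) witt" where
  "ham_h r = D (cvec (bar r)) r"

definition ham_d :: "'n::finite + 'n \<Rightarrow> ('n::finite + 'n) witt" where
  "ham_d i = D (axis i 1) 0"

definition ham :: "('n::finite + 'n) witt set" where
  "ham = module.span witt_scale ({ham_h r |r. r \<noteq> 0} \<union> range ham_d)"


section \<open>The Shen-Larsson functor\<close>

text \<open>\<open>V \<otimes> A\<^sub>N\<close> is the space of finitely supported functions \<open>\<int>\<^sup>N \<Rightarrow> V\<close>, with \<open>v \<otimes> t\<^sup>s\<close> being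
  \<open>Poly_Mapping.single s v\<close>.\<close>

type_synonym ('n, 'v) tensor_A = "(int ^ ('n + 'n)) \<Rightarrow>\<^sub>0 'v"

definition outer :: "complex ^ 'm \<Rightarrow> complex ^ 'm \<Rightarrow> complex ^ 'm ^ 'm" where
  "outer u v = (\<chi> i j. u $ i * v $ j)"

context
  fixes smul :: "complex \<Rightarrow> 'v::ab_group_add \<Rightarrow> 'v"
    and act :: "'n::{finite,linorder} cmat \<Rightarrow> 'v \<Rightarrow> 'v"
    and \<alpha> \<beta> :: "complex ^ ('n + 'n)"
begin

definition F_h :: "int ^ ('n + 'n) \<Rightarrow> ('n, 'v) tensor_A \<Rightarrow> ('n, 'v) tensor_A" where
  "F_h r f = (\<Sum>s\<in>Poly_Mapping.keys f.
     (let v = Poly_Mapping.lookup f s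
      in Poly_Mapping.single (r + s)
           (smul (pair (cvec (bar r)) (cvec s + \<alpha>)) v + act (outer (cvec r) (cvec (bar r))) v)))"

definition F_d :: "'n + 'n \<Rightarrow> ('n, 'v) tensor_A \<Rightarrow> ('n, 'v) tensor_A" where
  "F_d i f = (\<Sum>s\<in>Poly_Mapping.keys f.
     Poly_Mapping.single s (smul (of_int (s $ i) + \<beta> $ i) (Poly_Mapping.lookup f s)))"

text \<open>The linear extension to \<open>ham\<close>: an element \<open>x\<close> of \<open>ham\<close> is uniquely
  \<open>(\<Sum>r \<noteq> 0. c\<^sub>r h\<^sub>r) + (\<Sum>i. u\<^sub>i d\<^sub>i)\<close>, where \<open>c\<^sub>r\<close> is obtained from the \<open>r\<close>-th value of \<open>x\<close>, which is
  \<open>c\<^sub>r\<close> times \<open>bar r\<close>, and \<open>u\<close> is the value of \<open>x\<close> at \<open>0\<close>.\<close>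

definition F_act :: "('n + 'n) witt \<Rightarrow> ('n, 'v) tensor_A \<Rightarrow> ('n, 'v) tensor_A" where
  "F_act x f =
    (\<Sum>r\<in>Poly_Mapping.keys x - {0}.
       pm_scale smul (THE c. Poly_Mapping.lookup x r = c *s cvec (bar r)) (F_h r f)) +
    (\<Sum>i\<in>UNIV. pm_scale smul (Poly_Mapping.lookup x 0 $ i) (F_d i f))"

definition F_irreducible :: bool where
  "F_irreducible \<longleftrightarrow> irreducible_lie_module ham witt_scale witt_bracket (pm_scale smul) F_act"

end


section \<open>Consistency of the encodings\<close>

lemma vector_space_mat_scale: "vector_space mat_scale"
  by unfold_locales (auto simp: mat_scale_def vec_eq_iff algebra_simps)

lemma lookup_pm_scale:
  assumes "vector_space smul"
  shows "Poly_Mapping.lookup (pm_scale smul c f) k = smul c (Poly_Mapping.lookup f k)"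
proof -
  interpret vector_space smul by fact
  show ?thesis by (simp add: pm_scale_def Poly_Mapping.map.rep_eq when_def)
qed

lemma vector_space_pm_scale:
  assumes "vector_space smul"
  shows "vector_space (pm_scale smul)"
proof -
  interpret vector_space smul by fact
  show ?thesis
    by unfold_locales
      (auto intro!: poly_mapping_eqI simp: lookup_pm_scale[OF assms] lookup_add
        scale_left_distrib scale_right_distrib)
qed

lemma ham_h_0: "ham_h 0 = 0"
  by (simp add: ham_h_def D_def bar_def cvec_def)
    (rule poly_mapping_eqI, auto simp: lookup_single when_def vec_eq_iff split: sum.split)

lemma cvec_bar_eq_0_iff: "cvec (bar r) = 0 \<longleftrightarrow> r = 0"
  for r :: "int ^ ('n::finite + 'n)"
proof
  assume a: "cvec (bar r) = 0"
  show "r = 0"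
  proof (subst vec_eq_iff, rule allI)
    fix i
    show "r $ i = 0 $ i"
    proof (cases i)
      case (Inl k)
      then show ?thesis using arg_cong[OF a, of "\<lambda>v. v $ Inr k"] by (simp add: cvec_def bar_def)
    next
      case (Inr k)
      then show ?thesis using arg_cong[OF a, of "\<lambda>v. v $ Inl k"] by (simp add: cvec_def bar_def)
    qed
  qed
qed (auto simp: cvec_def bar_def vec_eq_iff split: sum.split)

lemma witt_bracket_D:
  "witt_bracket (D u r) (D v s) = D (pair u (cvec s) *s v - pair v (cvec r) *s u) (r + s)"
  by (cases "u = 0"; cases "v = 0")
    (auto simp: witt_bracket_def D_def pair_def Let_def)

lemma cvec_add: "cvec (r + s) = cvec r + cvec s"
  by (simp add: cvec_def vec_eq_iff)

lemma bar_add: "bar (r + s) = bar r + bar s"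
  by (auto simp: bar_def vec_eq_iff split: sum.split)

lemma sum_UNIV_sum: "(\<Sum>i\<in>UNIV. g i) = (\<Sum>k\<in>UNIV. g (Inl k)) + (\<Sum>k\<in>UNIV. g (Inr k))"
  for g :: "'n::finite + 'n \<Rightarrow> 'c::comm_monoid_add"
  unfolding UNIV_sum by (subst sum.union_disjoint) (auto simp: sum.reindex)

lemma pair_bar_skew: "pair (cvec (bar s)) (cvec r) = - pair (cvec (bar r)) (cvec s)"
  for r s :: "int ^ ('n::finite + 'n)"
  by (simp add: pair_def sum_UNIV_sum cvec_def bar_def sum_negf mult.commute)

lemma witt_bracket_ham_h:
  "witt_bracket (ham_h r) (ham_h s) = witt_scale (pair (cvec (bar r)) (cvec s)) (ham_h (r + s))"
  unfolding ham_h_def witt_bracket_D pair_bar_skew[of s r]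
  by (rule poly_mapping_eqI)
    (simp add: lookup_pm_scale[OF vec.vector_space_axioms] D_def lookup_single when_def bar_add
      cvec_add vec.scale_right_distrib vec.scale_minus_left add.commute)

lemma pair_axis: "pair (axis i 1) v = v $ i"
  by (simp add: pair_def axis_def if_distrib[of "\<lambda>x. x * _"] cong: if_cong)

lemma witt_bracket_ham_d_h: "witt_bracket (ham_d i) (ham_h r) = witt_scale (of_int (r $ i)) (ham_h r)"
proof -
  have 1: "pair u (cvec 0) = 0" for u :: "complex ^ ('a + 'a)"
    by (simp add: pair_def cvec_def)
  show ?thesis
    unfolding ham_h_def ham_d_def witt_bracket_D pair_axis 1
    by (rule poly_mapping_eqI)
      (simp add: lookup_pm_scale[OF vec.vector_space_axioms] D_def lookup_single when_def cvec_def)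
qed

lemma witt_bracket_ham_d_d: "witt_bracket (ham_d i) (ham_d j) = 0"
  by (simp add: ham_d_def witt_bracket_D pair_def cvec_def) (simp add: D_def)

lemma F_h_single:
  assumes "vector_space smul" and "\<And>x. act x 0 = 0"
  shows "F_h smul act \<alpha> r (Poly_Mapping.single s v) =
    Poly_Mapping.single (r + s)
      (smul (pair (cvec (bar r)) (cvec s + \<alpha>)) v + act (outer (cvec r) (cvec (bar r))) v)"
proof -
  interpret vector_space smul by fact
  show ?thesis by (cases "v = 0") (auto simp: F_h_def assms(2))
qed

lemma F_act_ham_d:
  assumes "vector_space smul"
  shows "F_act smul act \<alpha> \<beta> (ham_d i) f = F_d smul \<beta> i f"
proof -
  interpret P: vector_space "pm_scale smul" by (rule vector_space_pm_scale[OF assms])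
  have "(\<Sum>j\<in>UNIV. pm_scale smul (axis i 1 $ j) (F_d smul \<beta> j f)) =
      (\<Sum>j\<in>UNIV. if j = i then F_d smul \<beta> j f else 0)"
    by (rule sum.cong) (auto simp: axis_def)
  then show ?thesis by (simp add: F_act_def ham_d_def D_def axis_eq_0_iff)
qed

lemma F_act_ham_h:
  assumes "vector_space smul" and "r \<noteq> 0"
  shows "F_act smul act \<alpha> \<beta> (ham_h r) f = F_h smul act \<alpha> r f"
proof -
  interpret P: vector_space "pm_scale smul" by (rule vector_space_pm_scale[OF assms(1)])
  have nz: "cvec (bar r) \<noteq> 0" using assms(2) by (simp add: cvec_bar_eq_0_iff)
  have "(THE c. cvec (bar r) = c *s cvec (bar r)) = 1"
  proof (rule the_equality)
    fix c assume "cvec (bar r) = c *s cvec (bar r)"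
    then have "(c - 1) *s cvec (bar r) = 0" by (metis vec.scale_left_diff_distrib vec.scale_one cancel_comm_monoid_add_class.diff_cancel)
    then show "c = 1" using nz by (metis vec.scale_eq_0_iff eq_iff_diff_eq_0)
  qed simp
  then show ?thesis using nz assms(2) by (simp add: F_act_def ham_h_def D_def lookup_single)
qed

lemma D_add: "D (u + v) r = D u r + D v r"
  by (simp add: D_def single_add)

lemma pair_add_left: "pair (u + v) w = pair u w + pair v w"
  by (simp add: pair_def sum.distrib algebra_simps)

lemma pair_add_right: "pair w (u + v) = pair w u + pair w v"
  by (simp add: pair_def sum.distrib algebra_simps)

lemma pair_scale_left: "pair (c *s u) w = c * pair u w"
  by (simp add: pair_def sum_distrib_left algebra_simps)

lemma pair_diff_left: "pair (u - v) w = pair u w - pair v w"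
  by (simp add: pair_def sum_subtractf algebra_simps)

lemma pair_0_left: "pair 0 w = 0"
  by (simp add: pair_def)

lemma witt_apply_add_left: "witt_apply (x + y) f = witt_apply x f + witt_apply y f"
  unfolding witt_apply_def
  by (rule setsum_keys_plus_distrib)
    (auto simp: pair_0_left pair_add_left sum.distrib[symmetric] single_add[symmetric] distrib_right)

lemma witt_apply_add_right: "witt_apply x (f + g) = witt_apply x f + witt_apply x g"
  unfolding witt_apply_def sum.distrib[symmetric]
  by (rule sum.cong[OF refl], rule setsum_keys_plus_distrib)
    (auto simp: single_add[symmetric] algebra_simps)

lemma witt_apply_single:
  "witt_apply (D u r) (Poly_Mapping.single s c) = Poly_Mapping.single (r + s) (pair u (cvec s) * c)"
  by (cases "u = 0"; cases "c = 0") (auto simp: witt_apply_def D_def pair_def)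

lemma poly_mapping_add_induct [case_names zero single add]:
  assumes "P 0" and "\<And>k v. P (Poly_Mapping.single k v)" and "\<And>f g. P f \<Longrightarrow> P g \<Longrightarrow> P (f + g)"
  shows "P (f :: 'k \<Rightarrow>\<^sub>0 'v::comm_monoid_add)"
proof (induction f rule: update_induct)
  case (update f a b)
  have "Poly_Mapping.update a b f = Poly_Mapping.single a b + f"
    using update(1) by (intro poly_mapping_eqI)
      (auto simp: lookup_update lookup_add lookup_single when_def in_keys_iff)
  then show ?case using assms update by simp
qed (rule assms)

lemma witt_bracket_add_left: "witt_bracket (x + y) z = witt_bracket x z + witt_bracket y z"
  unfolding witt_bracket_def Let_def
  by (rule setsum_keys_plus_distrib)
    (auto simp: pair_0_left pair_add_left D_add[symmetric] sum.distrib[symmetric]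
      algebra_simps vec.scale_left_distrib vec.scale_right_distrib intro!: sum.cong,
     simp add: D_def)

lemma witt_bracket_add_right: "witt_bracket z (x + y) = witt_bracket z x + witt_bracket z y"
  unfolding witt_bracket_def Let_def sum.distrib[symmetric]
  by (rule sum.cong[OF refl], rule setsum_keys_plus_distrib)
    (auto simp: pair_0_left pair_add_left D_add[symmetric] algebra_simps vec.scale_left_distrib
      vec.scale_right_distrib, simp add: D_def)

lemma witt_apply_bracket:
  "witt_apply (witt_bracket x y) f = witt_apply x (witt_apply y f) - witt_apply y (witt_apply x f)"
proof (induction x rule: poly_mapping_add_induct)
  case zero
  show ?case by (simp add: witt_bracket_def witt_apply_def)
next
  case (add x1 x2)
  then show ?case by (simp add: witt_bracket_add_left witt_apply_add_left witt_apply_add_right)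
next
  case (single r u)
  show ?case
  proof (induction y rule: poly_mapping_add_induct)
    case zero
    show ?case by (simp add: witt_bracket_def witt_apply_def)
  next
    case (add y1 y2)
    then show ?case by (simp add: witt_bracket_add_right witt_apply_add_left witt_apply_add_right)
  next
    case (single s v)
    show ?case
    proof (induction f rule: poly_mapping_add_induct)
      case zero
      show ?case by (simp add: witt_apply_def)
    next
      case (add f1 f2)
      then show ?case by (simp add: witt_apply_add_right)
    next
      case (single p c)
      show ?case
        unfolding D_def[symmetric] witt_bracket_D witt_apply_single
        by (simp add: pair_diff_left pair_scale_left cvec_add pair_add_right single_diff[symmetric]
            algebra_simps)
    qed
  qed
qed

lemma outer_mem_sp: "outer (cvec r) (cvec (bar r)) \<in> sp"
proof -
  interpret M: vector_space mat_scale by (rule vector_space_mat_scale)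
  let ?S = "range sp_h \<union> {X_minus i j |i j. i \<noteq> j} \<union> {X_pos k l |k l. k \<le> l} \<union>
    {X_neg k l |k l. k \<le> l} :: 'a cmat set"
  have sp: "sp = M.span ?S" by (simp add: sp_def)
  have m: "X_minus i j \<in> sp" for i j :: 'a
  proof (cases "i = j")
    case True
    then have "X_minus i j = sp_h i" by (simp add: X_minus_def sp_h_def)
    then show ?thesis unfolding sp by (intro M.span_base) auto
  qed (unfold sp, intro M.span_base, auto)
  have p: "X_pos i j \<in> sp" for i j :: 'a
  proof (cases "i \<le> j")
    case False
    then have "X_pos i j = X_pos j i" "j \<le> i" by (auto simp: X_pos_def add.commute)
    then show ?thesis unfolding sp by (intro M.span_base) auto
  qed (unfold sp, intro M.span_base, auto)
  have n: "X_neg i j \<in> sp" for i j :: 'a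
  proof (cases "i \<le> j")
    case False
    then have "X_neg i j = X_neg j i" "j \<le> i" by (auto simp: X_neg_def add.commute)
    then show ?thesis unfolding sp by (intro M.span_base) auto
  qed (unfold sp, intro M.span_base, auto)
  define a where "a i = (of_int (r $ Inl i) :: complex)" for i
  define b where "b i = (of_int (r $ Inr i) :: complex)" for i
  define A where "A = (\<Sum>i\<in>UNIV. \<Sum>j\<in>UNIV. mat_scale (a i * b j) (X_minus i j) +
    mat_scale (- a i * a j / 2) (X_pos i j) + mat_scale (b i * b j / 2) (X_neg i j))"
  have "A \<in> sp"
    unfolding A_def sp
    by (intro M.span_sum M.span_add M.span_scale m[unfolded sp] n[unfolded sp] p[unfolded sp])
  moreover have "A = outer (cvec r) (cvec (bar r))"
  proof -
    have d: "(\<Sum>i\<in>UNIV. \<Sum>j\<in>UNIV. if x = i \<and> y = j then g i j else 0) = g x y"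
      for x y and g :: "'a \<Rightarrow> 'a \<Rightarrow> complex"
    proof -
      have "(\<Sum>i\<in>UNIV. \<Sum>j\<in>UNIV. if x = i \<and> y = j then g i j else 0)
          = (\<Sum>i\<in>UNIV. if x = i then g i y else 0)"
        by (intro sum.cong refl) auto
      then show ?thesis by simp
    qed
    have d': "(\<Sum>i\<in>UNIV. \<Sum>j\<in>UNIV. if x = j \<and> y = i then g i j else 0) = g y x"
      for x y and g :: "'a \<Rightarrow> 'a \<Rightarrow> complex"
      using d[of y x g] by (simp add: conj_commute)
    have "A $ x $ y = cvec r $ x * cvec (bar r) $ y" for x y
    proof (cases x; cases y)
      fix i j assume "x = Inl i" "y = Inl j"
      then show ?thesis
        by (simp add: A_def mat_scale_def X_minus_def X_pos_def X_neg_def E_def cvec_def bar_def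
            a_def b_def if_distrib[of "\<lambda>x. _ * x"] d cong: if_cong)
    next
      fix i j assume "x = Inr i" "y = Inr j"
      then show ?thesis
        by (simp add: A_def mat_scale_def X_minus_def X_pos_def X_neg_def E_def cvec_def bar_def
            a_def b_def if_distrib[of "\<lambda>x. _ * x"] if_distrib[of uminus] d' cong: if_cong)
    next
      fix i j assume "x = Inl i" "y = Inr j"
      then show ?thesis
        by (simp add: A_def mat_scale_def X_minus_def X_pos_def X_neg_def E_def cvec_def bar_def
            a_def b_def if_distrib[of "\<lambda>x. _ * x"] distrib_left sum.distrib d d' sum_negf
            sum_subtractf cong: if_cong)
    next
      fix i j assume "x = Inr i" "y = Inl j"
      then show ?thesis
        by (simp add: A_def mat_scale_def X_minus_def X_pos_def X_neg_def E_def cvec_def bar_def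
            a_def b_def if_distrib[of "\<lambda>x. _ * x"] distrib_left sum.distrib d d' cong: if_cong)
    qed
    then show ?thesis by (simp add: vec_eq_iff outer_def)
  qed
  ultimately show ?thesis by simp
qed

lemma is_V_delta_iso:
  fixes smul1 :: "complex \<Rightarrow> 'v::ab_group_add \<Rightarrow> 'v"
    and smul2 :: "complex \<Rightarrow> 'w::ab_group_add \<Rightarrow> 'w"
    and act1 :: "'n::{finite,linorder} cmat \<Rightarrow> 'v \<Rightarrow> 'v"
  assumes iso: "lie_module_iso sp smul1 act1 smul2 act2"
    and V: "is_V_delta k smul1 act1" and W: "lie_module sp mat_scale mat_bracket smul2 act2"
  shows "is_V_delta k smul2 act2"
proof -
  from V interpret V: irreducible_lie_module sp mat_scale mat_bracket smul1 act1
    by (simp add: is_V_delta_def)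
  interpret W: lie_module sp mat_scale mat_bracket smul2 act2 by fact
  interpret M: vector_space "mat_scale :: complex \<Rightarrow> 'n cmat \<Rightarrow> 'n cmat"
    by (rule vector_space_mat_scale)
  from iso obtain \<phi> where lin: "Vector_Spaces.linear smul1 smul2 \<phi>" and bij: "bij \<phi>"
    and act: "\<And>x v. x \<in> sp \<Longrightarrow> \<phi> (act1 x v) = act2 x (\<phi> v)"
    by (auto simp: lie_module_iso_def)
  interpret \<phi>: Vector_Spaces.linear smul1 smul2 \<phi> by fact
  have inj: "\<phi> v = 0 \<longleftrightarrow> v = 0" for v
    using bij \<phi>.zero by (metis bij_is_inj injD)
  have irr: "irreducible_sp_module smul2 act2"
  proof unfold_locales
    from V.nonzero obtain v :: 'v where "v \<noteq> 0" by blast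
    then show "\<exists>w::'w. w \<noteq> 0" using inj by blast
  next
    fix U assume U: "W.submodule U"
    have "V.submodule (\<phi> -` U)"
      using U unfolding V.submodule_def W.submodule_def V.subspace_def W.subspace_def
      by (auto simp: \<phi>.zero \<phi>.add \<phi>.scale act)
    then consider "\<phi> -` U = {0}" | "\<phi> -` U = UNIV" using V.simple by blast
    moreover have "U = \<phi> ` (\<phi> -` U)" using bij by (simp add: bij_is_surj surj_image_vimage_eq)
    ultimately show "U = {0} \<or> U = UNIV"
      using bij by cases (simp_all add: \<phi>.zero bij_is_surj)
  qed
  from V obtain B where B: "finite B" "V.span B = UNIV" by (auto simp: is_V_delta_def finite_dim_def)
  have "W.span (\<phi> ` B) = UNIV"
    using B bij by (simp add: \<phi>.span_image bij_is_surj)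
  then have fin: "finite_dim smul2" using B(1) unfolding finite_dim_def by blast
  from V obtain \<mu> v where \<mu>: "is_fundamental_weight k \<mu>" and v: "highest_weight_vector smul1 act1 \<mu> v"
    by (auto simp: is_V_delta_def)
  have "cartan \<subseteq> (sp :: 'n cmat set)"
    unfolding cartan_def sp_def by (intro M.span_mono) auto
  moreover have "X_minus i j \<in> sp" if "i < j" for i j :: 'n
    unfolding sp_def by (rule M.span_base) (use that in auto)
  moreover have "X_pos i j \<in> sp" if "i \<le> j" for i j :: 'n
    unfolding sp_def by (rule M.span_base) (use that in auto)
  ultimately have "highest_weight_vector smul2 act2 \<mu> (\<phi> v)"
    using v unfolding highest_weight_vector_def
    by (auto simp: act[symmetric] inj \<phi>.scale subset_iff)
  with irr fin \<mu> show ?thesis unfolding is_V_delta_def by blast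
qed

end

theory Submission
  imports Defs
begin

text \<open>
  Let \<open>\<omega>(u, w) = (bar u, w)\<close> be the symplectic form on \<open>\<complex>\<^sup>N\<close>, and let \<open>X\<^sub>p\<close> be the operator by which the
  matrix \<open>p (bar p)\<^sup>t\<close> acts on \<open>V\<close>. The operators \<open>X\<^sub>p\<close> span the image of \<open>sp\<^sub>N\<close>. In the fibre \<open>V \<otimes> t\<^sup>s\<close>, with
  \<open>w = s + \<alpha>\<close>, the element \<open>h\<^sub>r\<close> acts as \<open>\<omega>(r, w) + X\<^sub>r\<close>, with values in the fibre over \<open>r + s\<close>. The \<open>d\<^sub>i\<close>
  separate the fibres, so a submodule is a sum of subspaces \<open>M\<^sub>s \<otimes> t\<^sup>s\<close>. Irreducibility is decided by
  the squares \<open>X\<^sub>p\<^sup>2\<close>.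

  Suppose that some \<open>X\<^sub>p\<^sup>2\<close> with integral \<open>p\<close> is nonzero. The composition of \<open>h\<^sub>m\<^sub>p\<close> and \<open>h\<^sub>r\<^sub>-\<^sub>m\<^sub>p\<close> maps
  \<open>M\<^sub>s\<close> to \<open>M\<^sub>s\<^sub>+\<^sub>r\<close> for all \<open>m\<close>, and it is a polynomial in \<open>m\<close>, so its coefficients map \<open>M\<^sub>s\<close> to
  \<open>M\<^sub>s\<^sub>+\<^sub>r\<close> as well. The leading one is \<open>X\<^sub>p\<^sup>2\<close>, for every \<open>r\<close> (\<open>double_step\<close>). The common kernel of the
  \<open>X\<^sub>p\<^sup>2\<close> is an \<open>sp\<^sub>N\<close>-submodule (\<open>submodule_X_sq_kernel\<close>), hence zero, so that a nonzero submodule has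
  \<open>\<Inter>\<^sub>s M\<^sub>s \<noteq> 0\<close>. The quadratic coefficient of \<open>h\<^sub>m\<^sub>p\<close> shows that this intersection is \<open>sp\<^sub>N\<close>-stable
  (\<open>sg_fibres\<close>), so it is \<open>V\<close> and the submodule is everything (\<open>F_irreducible_if_nonzero_square\<close>).

  Suppose that all \<open>X\<^sub>p\<^sup>2\<close> vanish, but not all \<open>X\<^sub>p\<close>. Then \<open>(\<omega>(r, w) + X\<^sub>r) X\<^sub>w = X\<^sub>w\<^sub>+\<^sub>r X\<^sub>w\<close>, so the images
  of the \<open>X\<^sub>s\<^sub>+\<^sub>\<alpha>\<close> form a submodule. It is proper because \<open>X\<^sub>s\<^sub>+\<^sub>\<alpha>\<close> is nilpotent
  (\<open>F_reducible_if_squares_zero\<close>). If all \<open>X\<^sub>p\<close> vanish, then \<open>V\<close> is one-dimensional, and the only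
  obstruction to irreducibility is a fibre with \<open>s + \<alpha> = 0\<close> (\<open>F_irreducible_trivial_iff\<close>).

  It remains to see that the \<open>X\<^sub>p\<^sup>2\<close> vanish precisely on the modules \<open>V(\<delta>\<^sub>k)\<close>. On \<open>V(\<delta>\<^sub>k)\<close> the square for
  the lowest root vector kills the highest weight vector by \<open>sl\<^sub>2\<close>-theory, unipotent elements that fix
  this vector spread the vanishing to all \<open>p\<close>, and the kernel submodule spreads it to all vectors
  (\<open>X_sq_zero_of_V_delta\<close>). Conversely, if the squares vanish for integral \<open>p\<close>, then for
  unit vectors \<open>a\<close>, \<open>b\<close> the polarized operator \<open>S\<close> of \<open>X\<close> at \<open>a\<close>, \<open>b\<close> satisfies \<open>S\<^sup>3 = \<omega>(a, b)\<^sup>2 S\<close> (\<open>sg_cube\<close>). Consequently \<open>V\<close> is finite-dimensional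
  with weights in \<open>{-1, 0, 1}\<^sup>n\<close>, and its highest weight must be some \<open>\<delta>\<^sub>k\<close> (\<open>fundamental\<close>). The two
  directions together also carry the vanishing from integral \<open>p\<close> to complex \<open>p\<close>, which the submodule
  of images requires because \<open>s + \<alpha>\<close> need not be integral.
\<close>

section \<open>Linear algebra over the complex numbers\<close>

locale complex_space = vector_space smul
  for smul :: "complex \<Rightarrow> 'v::ab_group_add \<Rightarrow> 'v"
begin

text \<open>Replacing \<open>m\<close> by \<open>2m\<close> and subtracting \<open>2\<^sup>d\<close> times the original value removes the leading
  coefficient and multiplies each other one by a nonzero constant, which allows induction on the degree.\<close>

lemma polynomial_coefficients_in_subspace:
  assumes U: "subspace U"
    and mem: "\<And>m::nat. m > 0 \<Longrightarrow> (\<Sum>k\<le>d. smul (of_nat m ^ k) (v k)) \<in> U"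
    and "k \<le> d"
  shows "v k \<in> U"
  using mem \<open>k \<le> d\<close>
proof (induction d arbitrary: v k)
  case 0
  from "0.prems"(1)[of 1] "0.prems"(2) show ?case by simp
next
  case (Suc d)
  have low: "v k \<in> U" if "k \<le> d" for k
  proof -
    have "(\<Sum>k\<le>d. smul (of_nat m ^ k) (smul (2 ^ k - 2 ^ Suc d) (v k))) \<in> U" if "m > 0" for m :: nat
    proof -
      have "(\<Sum>k\<le>Suc d. smul (of_nat (2 * m) ^ k) (v k))
          - smul (2 ^ Suc d) (\<Sum>k\<le>Suc d. smul (of_nat m ^ k) (v k)) \<in> U"
        using that by (intro subspace_diff[OF U] subspace_scale[OF U] Suc.prems(1)) auto
      also have "(\<Sum>k\<le>Suc d. smul (of_nat (2 * m) ^ k) (v k))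
          - smul (2 ^ Suc d) (\<Sum>k\<le>Suc d. smul (of_nat m ^ k) (v k))
          = (\<Sum>k\<le>Suc d. smul (of_nat m ^ k) (smul (2 ^ k - 2 ^ Suc d) (v k)))"
        unfolding scale_sum_right sum_subtractf[symmetric]
        by (intro sum.cong refl)
          (simp only: scale_scale scale_left_diff_distrib[symmetric],
            simp add: power_mult_distrib algebra_simps)
      also have "\<dots> = (\<Sum>k\<le>d. smul (of_nat m ^ k) (smul (2 ^ k - 2 ^ Suc d) (v k)))"
        by simp
      finally show ?thesis .
    qed
    from Suc.IH[OF this \<open>k \<le> d\<close>] have *: "smul (2 ^ k - 2 ^ Suc d) (v k) \<in> U" .
    have "(2::real) ^ k < 2 ^ Suc d" using that by (intro power_strict_increasing) auto
    then have "complex_of_real (2 ^ k) \<noteq> complex_of_real (2 ^ Suc d)" unfolding of_real_eq_iff by simp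
    then have "(2::complex) ^ k - 2 ^ Suc d \<noteq> 0" by simp
    with subspace_scale[OF U *, of "inverse (2 ^ k - 2 ^ Suc d)"] show ?thesis by simp
  qed
  have "(\<Sum>k\<le>Suc d. smul (of_nat 1 ^ k) (v k)) - (\<Sum>k\<le>d. v k) \<in> U"
    by (intro subspace_diff[OF U] subspace_sum[OF U] Suc.prems(1) low) auto
  then have "v (Suc d) \<in> U" by simp
  with low Suc.prems(2) show ?case by (metis le_Suc_eq)
qed

lemma quartic_coefficients_in_subspace:
  assumes U: "subspace U"
    and mem: "\<And>m::nat. m > 0 \<Longrightarrow> v0 + smul (of_nat m) v1 + smul (of_nat m ^ 2) v2
      + smul (of_nat m ^ 3) v3 + smul (of_nat m ^ 4) v4 \<in> U"
  shows "v0 \<in> U" "v1 \<in> U" "v2 \<in> U" "v3 \<in> U" "v4 \<in> U"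
proof -
  define v where "v k = [v0, v1, v2, v3, v4] ! k" for k
  have "(\<Sum>k\<le>4. smul (of_nat m ^ k) (v k)) \<in> U" if "m > 0" for m
    using mem[OF that] by (simp add: v_def eval_nat_numeral algebra_simps)
  note * = polynomial_coefficients_in_subspace[where v = v and d = 4, OF U this]
  show "v0 \<in> U" "v1 \<in> U" "v2 \<in> U" "v3 \<in> U" "v4 \<in> U"
    using *[of 0] *[of 1] *[of 2] *[of 3] *[of 4] by (simp_all add: v_def)
qed

text \<open>Applying \<open>H i - l a i\<close> to the sum removes \<open>u a\<close> and rescales the other summands, which gives an
  induction on the number of summands. A family of operators is allowed because no single \<open>d\<^sub>i\<close> has
  distinct eigenvalues on all fibres; joint eigenvalues suffice.\<close>

lemma eigenvectors_in_invariant_subspace: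
  assumes U: "subspace U" and inv: "\<And>i u. u \<in> U \<Longrightarrow> H i u \<in> U"
    and add: "\<And>i u w. H i (u + w) = H i u + H i w"
    and scale: "\<And>i c u. H i (smul c u) = smul c (H i u)"
    and "finite A" and eig: "\<And>i j. j \<in> A \<Longrightarrow> H i (u j) = smul (l j i) (u j)"
    and inj: "inj_on l A"
    and sum: "(\<Sum>j\<in>A. u j) \<in> U" and "a \<in> A"
  shows "u a \<in> U"
  using assms(5-)
proof (induction "card A" arbitrary: A a u)
  case 0
  then show ?case by simp
next
  case (Suc n)
  have H0: "H i 0 = 0" for i using add[of i 0 0] by simp
  have Hsum: "H i (sum f B) = (\<Sum>j\<in>B. H i (f j))" for i B and f :: "'c \<Rightarrow> 'v"
    by (induction B rule: infinite_finite_induct) (auto simp: H0 add)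
  have rest: "u j \<in> U" if "j \<in> A - {a}" for j
  proof -
    from that inj_onD[OF Suc.prems(3), of j a] Suc.prems(5) obtain i where i: "l j i \<noteq> l a i" by blast
    have "H i (\<Sum>j\<in>A. u j) - smul (l a i) (\<Sum>j\<in>A. u j) \<in> U"
      using Suc.prems by (intro subspace_diff[OF U] inv subspace_scale[OF U]) auto
    also have "H i (\<Sum>j\<in>A. u j) - smul (l a i) (\<Sum>j\<in>A. u j) = (\<Sum>j\<in>A. smul (l j i - l a i) (u j))"
      unfolding Hsum scale_sum_right sum_subtractf[symmetric]
      by (intro sum.cong refl) (simp add: Suc.prems(2) scale_left_diff_distrib)
    also have "\<dots> = (\<Sum>j\<in>A - {a}. smul (l j i - l a i) (u j))"
      using Suc.prems by (subst sum.remove[of A a]) auto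
    finally have s: "(\<Sum>j\<in>A - {a}. smul (l j i - l a i) (u j)) \<in> U" .
    have Hs: "H k (smul c (u j)) = smul (l j k) (smul c (u j))" if "j \<in> A" for k c j
      using Suc.prems(2)[OF that] by (simp add: scale mult.commute)
    have "smul (l j i - l a i) (u j) \<in> U"
    proof (rule Suc.hyps(1)[of "A - {a}" "\<lambda>j. smul (l j i - l a i) (u j)"])
      show "n = card (A - {a})" using Suc.hyps(2) Suc.prems by simp
    qed (use Suc.prems s that Hs in \<open>auto intro: inj_on_subset\<close>)
    with subspace_scale[OF U this, of "inverse (l j i - l a i)"] i show ?thesis by simp
  qed
  have "(\<Sum>j\<in>A. u j) - (\<Sum>j\<in>A - {a}. u j) \<in> U"
    by (intro subspace_diff[OF U] subspace_sum[OF U] rest Suc.prems)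
  then show ?case using Suc.prems by (simp add: sum.remove[of A a])
qed

lemma double: "x + x = smul 2 x"
  using scale_left_distrib[of 1 1 x] by simp

lemma finite_dim_eigenvector_sequence:
  assumes fin: "finite_dim smul"
    and add: "\<And>u w. H (u + w) = H u + H w" and scale: "\<And>c u. H (smul c u) = smul c (H u)"
    and eig: "\<And>j::nat. H (u j) = smul (l j) (u j)" and inj: "inj l"
  shows "\<exists>j. u j = 0"
proof (rule ccontr)
  assume "\<nexists>j. u j = 0"
  then have nz: "u j \<noteq> 0" for j by blast
  from fin obtain B where B: "finite B" "span B = UNIV" unfolding finite_dim_def by blast
  have "inj u"
  proof (rule injI)
    fix i j assume "u i = u j"
    with eig[of i] eig[of j] have "smul (l i) (u j) = smul (l j) (u j)" by metis
    with nz inj show "i = j" by (auto dest: injD)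
  qed
  define T where "T = u ` {..card B}"
  have "independent T"
  proof (rule independent_if_scalars_zero)
    fix f x assume *: "(\<Sum>x\<in>T. smul (f x) x) = 0" and x: "x \<in> T"
    from x obtain a where a: "a \<le> card B" "x = u a" by (auto simp: T_def)
    have "(\<Sum>j\<le>card B. smul (f (u j)) (u j)) = 0"
      using * \<open>inj u\<close> by (simp add: T_def sum.reindex inj_on_subset[of u UNIV])
    then have sum0: "(\<Sum>j\<in>{..card B}. smul (f (u j)) (u j)) \<in> {0}" by simp
    have H0: "H 0 = 0" using add[of 0 0] by simp
    have "smul (f (u a)) (u a) \<in> {0}"
    proof (rule eigenvectors_in_invariant_subspace[where H = "\<lambda>_::unit. H" and l = "\<lambda>j _. l j" and A = "{..card B}"])
      show "inj_on (\<lambda>j _. l j) {..card B}"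
        using inj by (auto simp: inj_on_def fun_eq_iff dest: injD)
    qed (use sum0 a in \<open>auto simp: add scale eig H0 mult.commute\<close>)
    with nz a show "f x = 0" by simp
  qed (simp add: T_def)
  then have "card T \<le> card B"
    using independent_span_bound[OF B(1), of T] B(2) by auto
  moreover have "card T = Suc (card B)"
    unfolding T_def using \<open>inj u\<close> by (subst card_image) (auto intro: inj_on_subset)
  ultimately show False by simp
qed

end

section \<open>The symplectic Lie algebra\<close>

definition cbar :: "complex ^ ('n::finite + 'n) \<Rightarrow> complex ^ ('n + 'n)" where
  "cbar u = (\<chi> i. case i of Inl k \<Rightarrow> u $ Inr k | Inr k \<Rightarrow> - u $ Inl k)"

definition omega :: "complex ^ ('n::finite + 'n) \<Rightarrow> complex ^ ('n + 'n) \<Rightarrow> complex" where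
  "omega u w = pair (cbar u) w"

text \<open>The isomorphism between the symmetric square of \<open>\<complex>\<^sup>N\<close> and \<open>sp\<^sub>N\<close>, on decomposable tensors. Note that
  \<open>symm u u\<close> is twice the matrix \<open>u (bar u)\<^sup>t\<close> that enters the action of \<open>h\<^sub>u\<close>.\<close>

definition symm :: "complex ^ ('n::finite + 'n) \<Rightarrow> complex ^ ('n + 'n) \<Rightarrow> 'n cmat" where
  "symm u w = outer u (cbar w) + outer w (cbar u)"

abbreviation unit_vec :: "'m \<Rightarrow> complex ^ 'm" where
  "unit_vec a \<equiv> axis a 1"

lemma cbar_simps [simp]:
  "cbar (u + w) = cbar u + cbar w" "cbar (c *s u) = c *s cbar u" "cbar 0 = 0"
  "cbar (- u) = - cbar u" "cbar (u - w) = cbar u - cbar w"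
  by (auto simp: cbar_def vec_eq_iff split: sum.split)

lemma cbar_unit_vec:
  "cbar (unit_vec (Inl k)) = - unit_vec (Inr k)" "cbar (unit_vec (Inr k)) = unit_vec (Inl k)"
  by (auto simp: cbar_def vec_eq_iff axis_def split: sum.split)

lemma cvec_bar: "cvec (bar r) = cbar (cvec r)"
  by (auto simp: cbar_def cvec_def bar_def vec_eq_iff split: sum.split)

lemma cvec_of_nat_scale: "cvec (of_nat m *s p) = of_nat m *s cvec p"
  by (simp add: cvec_def vec_eq_iff)

lemma cvec_diff: "cvec (r - s) = cvec r - cvec s"
  by (simp add: cvec_def vec_eq_iff)

lemma cvec_axis: "cvec (axis a 1) = unit_vec a"
  by (auto simp: cvec_def vec_eq_iff axis_def)

lemma omega_expand:
  "omega u w = (\<Sum>k\<in>UNIV. u $ Inr k * w $ Inl k) - (\<Sum>k\<in>UNIV. u $ Inl k * w $ Inr k)"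
  unfolding omega_def pair_def cbar_def UNIV_sum
  by (subst sum.union_disjoint) (auto simp: sum.reindex sum_negf)

lemma omega_skew: "omega w u = - omega u w"
  by (simp add: omega_expand mult.commute)

lemma omega_self [simp]: "omega u u = 0"
  by (simp add: omega_expand mult.commute)

lemma omega_simps [simp]:
  "omega (u + u') w = omega u w + omega u' w" "omega w (u + u') = omega w u + omega w u'"
  "omega (u - u') w = omega u w - omega u' w" "omega w (u - u') = omega w u - omega w u'"
  "omega (c *s u) w = c * omega u w" "omega w (c *s u) = c * omega w u"
  "omega 0 w = 0" "omega w 0 = 0"
  by (simp_all add: omega_def pair_def sum.distrib sum_subtractf algebra_simps sum_distrib_left)

lemma omega_unit_vec:
  "omega (unit_vec (Inl k)) w = - w $ Inr k" "omega (unit_vec (Inr k)) w = w $ Inl k"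
  "omega w (unit_vec (Inl k)) = w $ Inr k" "omega w (unit_vec (Inr k)) = - w $ Inl k"
  by (simp_all add: omega_expand axis_def if_distrib[of "\<lambda>x. x * _"] if_distrib[of "\<lambda>x. _ * x"] cong: if_cong)

lemma symm_commute: "symm u w = symm w u"
  by (simp add: symm_def add.commute)

lemma symm_add: "symm (u + u') w = symm u w + symm u' w"
  by (simp add: symm_def outer_def vec_eq_iff algebra_simps)

lemma symm_scale: "symm (c *s u) w = mat_scale c (symm u w)"
  by (simp add: symm_def outer_def vec_eq_iff algebra_simps mat_scale_def)

lemma symm_unit_vec:
  "symm (unit_vec (Inl i)) (unit_vec (Inr j)) = X_minus i j"
  "symm (unit_vec (Inl i)) (unit_vec (Inr i)) = sp_h i"
  "symm (unit_vec (Inl i)) (unit_vec (Inl j)) = - X_pos i j"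
  "symm (unit_vec (Inr i)) (unit_vec (Inr j)) = X_neg i j"
proof -
  have "outer (unit_vec a) (unit_vec b) = E a b" "outer (unit_vec a) (- unit_vec b) = - E a b"
    for a b :: "'a + 'a"
    by (auto simp: outer_def E_def vec_eq_iff axis_def)
  then show "symm (unit_vec (Inl i)) (unit_vec (Inr j)) = X_minus i j"
    "symm (unit_vec (Inl i)) (unit_vec (Inr i)) = sp_h i"
    "symm (unit_vec (Inl i)) (unit_vec (Inl j)) = - X_pos i j"
    "symm (unit_vec (Inr i)) (unit_vec (Inr j)) = X_neg i j"
    by (simp_all add: symm_def cbar_unit_vec X_minus_def X_pos_def X_neg_def sp_h_def)
qed

lemma mat_mult_outer: "outer u x ** outer y z = mat_scale (pair x y) (outer u z)"
  by (simp add: matrix_matrix_mult_def outer_def vec_eq_iff mat_scale_def pair_def sum_distrib_left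
      sum_distrib_right mult.assoc mult.commute mult.left_commute)

lemma mat_bracket_symm:
  "mat_bracket (symm a b) (symm c d) = mat_scale (omega b c) (symm a d) + mat_scale (omega a c) (symm b d)
     + mat_scale (omega b d) (symm a c) + mat_scale (omega a d) (symm b c)"
proof -
  interpret M: vector_space "mat_scale :: complex \<Rightarrow> 'a cmat \<Rightarrow> 'a cmat"
    by (rule vector_space_mat_scale)
  have rdistrib: "(A + B) ** C = A ** C + B ** C" for A B C :: "'a cmat"
    by (simp add: matrix_matrix_mult_def vec_eq_iff distrib_right sum.distrib)
  have "omega d a = - omega a d" "omega d b = - omega b d" "omega c a = - omega a c" "omega c b = - omega b c"
    by (rule omega_skew)+
  then show ?thesis
    unfolding mat_bracket_def symm_def
    by (simp add: matrix_add_ldistrib rdistrib mat_mult_outer omega_def[symmetric]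
        M.scale_right_distrib algebra_simps)
qed

lemma X_in_sp: "X_minus i j \<in> sp" "X_pos i j \<in> sp" "X_neg i j \<in> sp" "sp_h i \<in> sp"
proof -
  interpret M: vector_space "mat_scale :: complex \<Rightarrow> 'a cmat \<Rightarrow> 'a cmat"
    by (rule vector_space_mat_scale)
  have "X_minus i i = sp_h i" "X_pos i j = X_pos j i" "X_neg i j = X_neg j i"
    by (simp_all add: X_minus_def sp_h_def X_pos_def X_neg_def add.commute)
  then show "X_minus i j \<in> sp" "X_pos i j \<in> sp" "X_neg i j \<in> sp" "sp_h i \<in> sp"
    unfolding sp_def
    by (cases "i = j"; cases "i \<le> j"; force intro: M.span_base)+
qed

text \<open>The root vectors and the \<open>h\<^sub>i\<close> are, up to sign, exactly the \<open>symm\<close> of pairs of unit vectors, so the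
  case distinction between the kinds of roots can be dropped from here on.\<close>

lemma sp_eq_span_symm:
  "(sp :: 'n::{finite,linorder} cmat set) = module.span mat_scale {symm (unit_vec a) (unit_vec b) |a b. True}"
  (is "_ = module.span _ ?G")
proof -
  interpret M: vector_space "mat_scale :: complex \<Rightarrow> 'n cmat \<Rightarrow> 'n cmat"
    by (rule vector_space_mat_scale)
  show ?thesis
  proof
    have G: "symm (unit_vec a) (unit_vec b) \<in> M.span ?G" for a b
      by (rule M.span_base) blast
    have "X_pos k l \<in> M.span ?G" for k l
      using M.span_neg[OF G[of "Inl k" "Inl l"]] by (simp add: symm_unit_vec)
    moreover have "X_minus k l \<in> M.span ?G" "X_neg k l \<in> M.span ?G" "sp_h k \<in> M.span ?G" for k l
      using G by (simp_all flip: symm_unit_vec)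
    ultimately show "sp \<subseteq> M.span ?G"
      unfolding sp_def by (intro M.span_minimal M.subspace_span) auto
    have "symm (unit_vec a) (unit_vec b) \<in> sp" for a b :: "'n + 'n"
    proof -
      have neg: "- x \<in> sp" if "x \<in> sp" for x :: "'n cmat"
        using that unfolding sp_def by (rule M.span_neg)
      show ?thesis
        by (cases a; cases b)
          (auto simp: symm_unit_vec symm_commute[of "unit_vec (Inr _)" "unit_vec (Inl _)"] X_in_sp neg)
    qed
    then show "M.span ?G \<subseteq> sp"
      unfolding sp_def by (intro M.span_minimal M.subspace_span) auto
  qed
qed

lemma symm_in_sp: "symm u w \<in> (sp :: 'n::{finite,linorder} cmat set)"
proof -
  interpret M: vector_space "mat_scale :: complex \<Rightarrow> 'n cmat \<Rightarrow> 'n cmat"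
    by (rule vector_space_mat_scale)
  have sub: "M.subspace sp" unfolding sp_def by (rule M.subspace_span)
  have reduce: "symm u w \<in> sp" if "\<And>a. symm (unit_vec a) w \<in> sp" for u w :: "complex ^ ('n + 'n)"
  proof -
    have "symm (\<Sum>a\<in>A. u $ a *s unit_vec a) w = (\<Sum>a\<in>A. mat_scale (u $ a) (symm (unit_vec a) w))" for A
      by (induction A rule: infinite_finite_induct)
        (auto simp: symm_add symm_scale, auto simp: symm_def outer_def vec_eq_iff)
    from this[of UNIV] have "symm u w = (\<Sum>a\<in>UNIV. mat_scale (u $ a) (symm (unit_vec a) w))"
      by (simp add: basis_expansion)
    then show ?thesis using that by (simp add: M.subspace_sum[OF sub] M.subspace_scale[OF sub])
  qed
  show ?thesis
    by (rule reduce, subst symm_commute, rule reduce) (auto simp: sp_eq_span_symm intro: M.span_base)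
qed

section \<open>Modules over the symplectic Lie algebra\<close>

locale sp_module = lie_module sp mat_scale mat_bracket smul act
  for smul :: "complex \<Rightarrow> 'v::ab_group_add \<Rightarrow> 'v"
    and act :: "'n::{finite,linorder} cmat \<Rightarrow> 'v \<Rightarrow> 'v"
begin

sublocale complex_space smul ..

text \<open>The action of \<open>sp\<^sub>N\<close> in terms of the symmetric square: bilinear and symmetric in the two vectors,
  with \<open>sg p p = 2 X\<^sub>p\<close>.\<close>

definition sg :: "complex ^ ('n + 'n) \<Rightarrow> complex ^ ('n + 'n) \<Rightarrow> 'v \<Rightarrow> 'v" where
  "sg u w v = act (symm u w) v"

abbreviation X_sq_zero :: "complex ^ ('n + 'n) \<Rightarrow> 'v \<Rightarrow> bool" where
  "X_sq_zero p v \<equiv> sg p p (sg p p v) = 0"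

lemma sg_commute: "sg u w v = sg w u v"
  by (simp add: sg_def symm_commute)

lemma sg_add [simp]: "sg u w (v + v') = sg u w v + sg u w v'"
  and sg_scale [simp]: "sg u w (smul c v) = smul c (sg u w v)"
  by (simp_all add: sg_def symm_in_sp act_add_right act_scale_right)

lemma sg_zero [simp]: "sg u w 0 = 0"
  using sg_add[of u w 0 0] by simp

lemma sg_minus [simp]: "sg u w (- v) = - sg u w v"
  using sg_scale[of u w "-1" v] by simp

lemma sg_diff [simp]: "sg u w (v - v') = sg u w v - sg u w v'"
  using sg_add[of u w v "- v'"] by simp

lemma sg_add_left [simp]: "sg (u + u') w v = sg u w v + sg u' w v"
  by (simp add: sg_def symm_add symm_in_sp act_add_left)

lemma sg_add_mid [simp]: "sg u (w + w') v = sg u w v + sg u w' v"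
  by (simp add: sg_commute[of u])

lemma sg_scale_left [simp]: "sg (c *s u) w v = smul c (sg u w v)"
  by (simp add: sg_def symm_scale symm_in_sp act_scale_left)

lemma sg_scale_mid [simp]: "sg u (c *s w) v = smul c (sg u w v)"
  by (simp add: sg_commute[of u])

lemma sg_diff_left [simp]: "sg (u - u') w v = sg u w v - sg u' w v"
  using sg_add_left[of "u - u'" u' w v] by simp

lemma sg_diff_mid [simp]: "sg w (u - u') v = sg w u v - sg w u' v"
  by (simp add: sg_commute[of w])

lemma sg_zero_left [simp]: "sg 0 w v = 0" "sg w 0 v = 0"
  using sg_scale_left[of 0 0 w v] sg_scale_mid[of w 0 0 v] by simp_all

lemma act_X: "act (outer u (cbar u)) v = smul (1/2) (sg u u v)"
proof -
  have "outer u (cbar u) = mat_scale (1/2) (symm u u)"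
    by (simp add: vec_eq_iff outer_def symm_def mat_scale_def)
  then show ?thesis by (simp add: sg_def act_scale_left symm_in_sp)
qed

lemma act_neg: "x \<in> sp \<Longrightarrow> act (- x) v = - act x v"
proof -
  have "- x = mat_scale (-1) x" by (simp add: mat_scale_def vec_eq_iff)
  then show "x \<in> sp \<Longrightarrow> act (- x) v = - act x v" by (simp add: act_scale_left)
qed

lemma act_zero: "act 0 v = 0"
  using act_scale_left[OF symm_in_sp, of 0 0 0 v]
  by (simp add: mat_scale_def symm_def outer_def zero_vec_def)

lemma act_X_root:
  "act (X_minus i j) v = sg (unit_vec (Inl i)) (unit_vec (Inr j)) v"
  "act (X_pos i j) v = - sg (unit_vec (Inl i)) (unit_vec (Inl j)) v"
  "act (X_neg i j) v = sg (unit_vec (Inr i)) (unit_vec (Inr j)) v"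
  "act (sp_h i) v = sg (unit_vec (Inl i)) (unit_vec (Inr i)) v"
  by (simp_all add: sg_def symm_unit_vec act_neg X_in_sp flip: symm_unit_vec(2))

text \<open>Apart from bilinearity and symmetry, all computations with \<open>sg\<close> rest on this commutation relation.\<close>

lemma sg_swap:
  "sg a b (sg c d v) = sg c d (sg a b v) + smul (omega b c) (sg a d v) + smul (omega a c) (sg b d v)
     + smul (omega b d) (sg a c v) + smul (omega a d) (sg b c v)"
proof -
  interpret M: vector_space "mat_scale :: complex \<Rightarrow> 'n cmat \<Rightarrow> 'n cmat"
    by (rule vector_space_mat_scale)
  have sub: "M.subspace sp" unfolding sp_def by (rule M.subspace_span)
  have "sg a b (sg c d v) - sg c d (sg a b v) = act (mat_bracket (symm a b) (symm c d)) v"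
    by (simp add: sg_def act_bracket symm_in_sp)
  also have "\<dots> = smul (omega b c) (sg a d v) + smul (omega a c) (sg b d v)
     + smul (omega b d) (sg a c v) + smul (omega a d) (sg b c v)"
    by (simp add: mat_bracket_symm act_add_left act_scale_left symm_in_sp M.subspace_add[OF sub]
        M.subspace_scale[OF sub] flip: sg_def)
  finally show ?thesis by (simp add: algebra_simps)
qed

lemma act_in_subspace:
  assumes U: "subspace U" and gen: "\<And>a b. sg (unit_vec a) (unit_vec b) v \<in> U" and x: "x \<in> sp"
  shows "act x v \<in> U"
proof -
  interpret M: vector_space "mat_scale :: complex \<Rightarrow> 'n cmat \<Rightarrow> 'n cmat"
    by (rule vector_space_mat_scale)
  have sub: "M.subspace sp" unfolding sp_def by (rule M.subspace_span)
  have "x \<in> sp \<and> act x v \<in> U"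
    using x[unfolded sp_eq_span_symm]
  proof (induction rule: M.span_induct_alt)
    case base
    show ?case using U M.subspace_0[OF sub] by (simp add: act_zero subspace_0)
  next
    case (step c x y)
    from step(1) obtain a b where ab: "x = symm (unit_vec a) (unit_vec b)" by blast
    have "mat_scale c x \<in> sp" by (simp add: ab M.subspace_scale[OF sub] symm_in_sp)
    with step(2) ab gen U show ?case
      by (simp add: act_add_left act_scale_left symm_in_sp M.subspace_add[OF sub] subspace_add
          subspace_scale flip: sg_def)
  qed
  then show ?thesis ..
qed

lemma submodule_iff_sg:
  "submodule U \<longleftrightarrow> subspace U \<and> (\<forall>a b. \<forall>v\<in>U. sg (unit_vec a) (unit_vec b) v \<in> U)"
  unfolding submodule_def using act_in_subspace by (auto simp: sg_def symm_in_sp)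

lemma X_sq_expand:
  "sg (p + t *s r) (p + t *s r) (sg (p + t *s r) (p + t *s r) v)
    = sg p p (sg p p v) + smul t (smul 2 (sg p p (sg p r v) + sg p r (sg p p v)))
      + smul (t ^ 2) (sg p p (sg r r v) + sg r r (sg p p v) + smul 4 (sg p r (sg p r v)))
      + smul (t ^ 3) (smul 2 (sg p r (sg r r v) + sg r r (sg p r v)))
      + smul (t ^ 4) (sg r r (sg r r v))"
proof -
  have two: "sg (p + t *s r) (p + t *s r) u = sg p p u + smul (2 * t) (sg p r u) + smul (t ^ 2) (sg r r u)" for u
  proof -
    have "smul (2 * t) (sg p r u) = smul t (sg p r u) + smul t (sg p r u)"
      by (simp add: scale_left_distrib[symmetric])
    then show ?thesis by (simp add: sg_commute[of r p] scale_right_distrib power2_eq_square)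
  qed
  show ?thesis
    unfolding two
    by (simp add: scale_right_distrib power2_eq_square power3_eq_cube power4_eq_xxxx ac_simps)
qed

text \<open>These are the first three coefficients of \<open>X\<^sub>p\<^sub>+\<^sub>m\<^sub>r\<^sup>2 v\<close> as a polynomial in \<open>m\<close>.\<close>

lemma polarized_X_sq:
  assumes "\<And>m::nat. m > 0 \<Longrightarrow> X_sq_zero (p + of_nat m *s r) v"
  shows "sg p p (sg p p v) = 0" "sg p p (sg p r v) + sg p r (sg p p v) = 0"
    "smul 4 (sg p r (sg p r v)) = - (sg p p (sg r r v) + sg r r (sg p p v))"
proof -
  have "subspace {0}" by (simp add: subspace_def)
  have mem: "sg p p (sg p p v) + smul (of_nat m) (smul 2 (sg p p (sg p r v) + sg p r (sg p p v)))
      + smul (of_nat m ^ 2) (sg p p (sg r r v) + sg r r (sg p p v) + smul 4 (sg p r (sg p r v)))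
      + smul (of_nat m ^ 3) (smul 2 (sg p r (sg r r v) + sg r r (sg p r v)))
      + smul (of_nat m ^ 4) (sg r r (sg r r v)) \<in> {0}" if "m > 0" for m :: nat
    unfolding X_sq_expand[symmetric] using assms[OF that] by blast
  note coeffs = quartic_coefficients_in_subspace(1-3)[OF \<open>subspace {0}\<close> mem]
  show "sg p p (sg p p v) = 0" "sg p p (sg p r v) + sg p r (sg p p v) = 0"
    "smul 4 (sg p r (sg p r v)) = - (sg p p (sg r r v) + sg r r (sg p p v))"
    using coeffs unfolding singleton_iff scale_eq_0_iff by (simp_all add: add_eq_0_iff)
qed

lemma sg_polarization:
  "sg a b v = smul (1/2) (sg (a + b) (a + b) v - sg a a v - sg b b v)"
  by (simp add: sg_commute[of b a] double)

text \<open>The commutator of \<open>X\<^sub>p\<^sup>2\<close> and \<open>X\<^sub>r\<close> is a multiple of the derivative of the square at \<open>p\<close> in the direction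
  \<open>r\<close>, and this derivative kills every vector on which the squares vanish along the line \<open>p + m r\<close>. The
  set \<open>P\<close> stands for the integral vectors in one application and for all vectors in the other.\<close>

lemma submodule_X_sq_kernel:
  assumes closed: "\<And>p q. p \<in> P \<Longrightarrow> q \<in> P \<Longrightarrow> p + q \<in> P" and unit: "\<And>a. unit_vec a \<in> P"
  shows "submodule {v. \<forall>p\<in>P. X_sq_zero p v}" (is "submodule ?K")
proof -
  have sub: "subspace ?K"
    by (auto simp: subspace_def)
  have line: "p + of_nat m *s r \<in> P" if "p \<in> P" "r \<in> P" for p r and m :: nat
  proof (induction m)
    case (Suc m)
    have "p + of_nat (Suc m) *s r = (p + of_nat m *s r) + r"
      by (simp add: vec.scale_left_distrib algebra_simps)
    then show ?case using closed[OF Suc that(2)] by metis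
  qed (use that in simp)
  have sq: "sg r r v \<in> ?K" if v: "v \<in> ?K" and r: "r \<in> P" for v r
  proof safe
    fix p assume p: "p \<in> P"
    have "X_sq_zero (p + of_nat m *s r) v" for m :: nat
      using line[OF p r] v by blast
    then have pol: "sg p p (sg p r v) = - sg p r (sg p p v)"
      using polarized_X_sq(2) by (subst eq_neg_iff_add_eq_0) blast
    have "sg p p (sg r r v) = sg r r (sg p p v) + smul (4 * omega p r) (sg p r v)" for v
      by (subst sg_swap) (simp add: algebra_simps flip: scale_left_distrib)
    then show "X_sq_zero p (sg r r v)"
      using v p by (simp add: pol)
  qed
  have "sg a b v \<in> ?K" if v: "v \<in> ?K" and ab: "a \<in> P" "b \<in> P" for v a b
  proof -
    have "sg a b v = smul (1/2) (sg (a + b) (a + b) v - sg a a v - sg b b v)" by (rule sg_polarization)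
    also have "\<dots> \<in> ?K"
      by (intro subspace_scale[OF sub] subspace_diff[OF sub] sq v ab closed)
    finally show ?thesis .
  qed
  with sub unit show ?thesis by (simp add: submodule_iff_sg)
qed

end

section \<open>Weights\<close>

abbreviation el :: "'n \<Rightarrow> complex ^ ('n::finite + 'n)" where "el i \<equiv> unit_vec (Inl i)"
abbreviation er :: "'n \<Rightarrow> complex ^ ('n::finite + 'n)" where "er i \<equiv> unit_vec (Inr i)"

lemma omega_units [simp]:
  "omega (el i) (el j) = 0" "omega (er i) (er j) = 0"
  "omega (el i) (er j) = (if i = j then -1 else 0)" "omega (er i) (el j) = (if i = j then 1 else 0)"
  unfolding omega_unit_vec by (auto simp: axis_def)

text \<open>The coordinates of the weight of a unit vector in the standard module \<open>\<complex>\<^sup>N\<close>.\<close>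

fun unit_weight :: "'n + 'n \<Rightarrow> 'n \<Rightarrow> int" where
  "unit_weight (Inl j) i = (if i = j then 1 else 0)"
| "unit_weight (Inr j) i = (if i = j then - 1 else 0)"

context sp_module
begin

definition weight_vector :: "('n \<Rightarrow> int) \<Rightarrow> 'v \<Rightarrow> bool" where
  "weight_vector m v \<longleftrightarrow> v \<noteq> 0 \<and> (\<forall>i. sg (el i) (er i) v = smul (of_int (m i)) v)"

lemma sg_weight_shift:
  assumes "weight_vector m v" and "sg (unit_vec a) (unit_vec b) v \<noteq> 0"
  shows "weight_vector (\<lambda>i. m i + unit_weight a i + unit_weight b i) (sg (unit_vec a) (unit_vec b) v)"
  unfolding weight_vector_def
proof (intro conjI allI)
  fix i
  have a: "omega (er i) (unit_vec a) = (if a = Inl i then 1 else 0)"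
    "omega (el i) (unit_vec a) = (if a = Inr i then -1 else 0)" for a :: "'n + 'n"
    by (cases a; simp)+
  have w: "unit_weight a i = (if a = Inl i then 1 else if a = Inr i then -1 else 0)" for a :: "'n + 'n"
    by (cases a) auto
  have v: "sg (el i) (er i) v = smul (of_int (m i)) v"
    using assms(1) by (simp add: weight_vector_def)
  show "sg (el i) (er i) (sg (unit_vec a) (unit_vec b) v) =
      smul (of_int (m i + unit_weight a i + unit_weight b i)) (sg (unit_vec a) (unit_vec b) v)"
    by (subst sg_swap) (auto simp: a w v sg_commute scale_left_distrib scale_left_diff_distrib)
qed fact

lemma sg_raise_lower:
  "sg (el i) (el i) (sg (er i) (er i) u) = sg (er i) (er i) (sg (el i) (el i) u) - smul 4 (sg (el i) (er i) u)"
proof -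
  have "smul 4 (sg (el i) (er i) u) = (sg (el i) (er i) u + sg (el i) (er i) u)
      + (sg (el i) (er i) u + sg (el i) (er i) u)"
    unfolding double by simp
  then show ?thesis by (subst sg_swap) (simp add: sg_commute[of "er i" "el i"])
qed

text \<open>For \<open>F = sg (er i) (er i)\<close> and \<open>E = sg (el i) (el i)\<close> one has
  \<open>E F\<^bsup>j+1\<^esup> v = -4 (j + 1) (c - j) F\<^bsup>j\<^esup> v\<close>. The scalar is nonzero for \<open>j \<ge> 2\<close>, so if \<open>F\<^sup>2 v\<close> were nonzero, all
  \<open>F\<^bsup>j\<^esup> v\<close> would be, and they have distinct weights.\<close>

lemma X_sq_zero_lowest:
  assumes fin: "finite_dim smul" and E: "sg (el i) (el i) v = 0"
    and H: "sg (el i) (er i) v = smul c v" and c: "c = 0 \<or> c = 1"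
  shows "X_sq_zero (er i) v"
proof (rule ccontr)
  let ?F = "sg (er i) (er i)" and ?E = "sg (el i) (el i)" and ?H = "sg (el i) (er i)"
  define u where "u j = (?F ^^ j) v" for j
  have u_Suc: "u (Suc j) = ?F (u j)" for j by (simp add: u_def)
  assume "\<not> X_sq_zero (er i) v"
  then have u2: "u 2 \<noteq> 0" by (simp add: u_def eval_nat_numeral)
  note EF = sg_raise_lower[of i]
  have HF: "?H (?F x) = ?F (?H x) - smul 2 (?F x)" for x
    by (subst sg_swap) (simp add: algebra_simps double sg_commute)
  have Hu: "?H (u j) = smul (c - 2 * of_nat j) (u j)" for j
  proof (induction j)
    case 0
    show ?case by (simp add: u_def H)
  next
    case (Suc j)
    have "?H (u (Suc j)) = smul (c - 2 * of_nat j) (u (Suc j)) - smul 2 (u (Suc j))"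
      by (simp add: u_Suc HF Suc)
    then show ?case by (simp only: scale_left_diff_distrib[symmetric]) (simp add: algebra_simps)
  qed
  have Eu: "?E (u (Suc j)) = smul (- 4 * of_nat (Suc j) * (c - of_nat j)) (u j)" for j
  proof (induction j)
    case 0
    show ?case by (simp add: u_Suc EF) (simp add: u_def E H)
  next
    case (Suc j)
    have "?E (u (Suc (Suc j))) = smul (- 4 * of_nat (Suc j) * (c - of_nat j)) (u (Suc j))
        - smul (4 * (c - 2 * of_nat (Suc j))) (u (Suc j))"
      unfolding u_Suc[of "Suc j"] EF Suc Hu by (simp add: u_Suc)
    also have "\<dots> = smul (- 4 * of_nat (Suc (Suc j)) * (c - of_nat (Suc j))) (u (Suc j))"
      unfolding scale_left_diff_distrib[symmetric] by (rule arg_cong[where f = "\<lambda>x. smul x _"]) (simp add: algebra_simps)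
    finally show ?case .
  qed
  have "u (j + 2) \<noteq> 0" for j
  proof (induction j)
    case (Suc j)
    have "of_nat (j + 2) \<noteq> c"
    proof
      assume "of_nat (j + 2) = c"
      with c have "of_nat (j + 2) = (of_nat 0 :: complex) \<or> of_nat (j + 2) = (of_nat 1 :: complex)" by simp
      then show False unfolding of_nat_eq_iff by simp
    qed
    then have "- 4 * of_nat (Suc (j + 2)) * (c - of_nat (j + 2)) \<noteq> 0"
      by (metis mult_eq_0_iff of_nat_eq_0_iff nat.distinct(1) eq_iff_diff_eq_0 neg_equal_0_iff_equal zero_neq_numeral)
    with Suc have "?E (u (Suc (j + 2))) \<noteq> 0" unfolding Eu scale_eq_0_iff by blast
    then show ?case by auto
  qed (metis u2 add_0)
  moreover have "\<exists>j. u (j + 2) = 0"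
  proof (rule finite_dim_eigenvector_sequence[OF fin, where H = ?H])
    show "?H (u (j + 2)) = smul (c - 2 * of_nat (j + 2)) (u (j + 2))" for j
      by (rule Hu)
  qed (auto simp: inj_def)
  ultimately show False by blast
qed

lemma sg_derivation:
  "sg a b (sg c d v) = sg c d (sg a b v) + sg (omega b c *s a + omega a c *s b) d v
     + sg c (omega b d *s a + omega a d *s b) v"
  by (subst sg_swap) (simp add: sg_commute[of _ c])

text \<open>The matrix \<open>B = symm x y\<close> has square zero and kills \<open>v\<close>, so \<open>f t = X\<^sub>w\<^sub>+\<^sub>t\<^sub>B\<^sub>w\<^sup>2 v\<close> is a polynomial in \<open>t\<close>
  with \<open>f' = B f\<close> and \<open>f 0 = 0\<close>. Its coefficients vanish one after the other.\<close>

lemma X_sq_zero_unipotent: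
  assumes Z: "X_sq_zero w v" and v: "sg x y v = 0" and xy: "omega x y = 0"
  shows "X_sq_zero (w + (omega y w *s x + omega x w *s y)) v"
proof -
  define w' where "w' = omega y w *s x + omega x w *s y"
  have w': "omega y w' = 0" "omega x w' = 0"
    using xy omega_skew[of x y] by (simp_all add: w'_def)
  have ww: "sg x y (sg w w u) = sg w w (sg x y u) + smul 2 (sg w w' u)" for u
    unfolding sg_derivation[of x y w w] w'_def[symmetric] by (simp add: sg_commute[of w' w] double)
  have ww': "sg x y (sg w w' u) = sg w w' (sg x y u) + sg w' w' u" for u
    unfolding sg_derivation[of x y w w'] w'_def[symmetric] by (simp add: w')
  have w'w': "sg x y (sg w' w' u) = sg w' w' (sg x y u)" for u
    unfolding sg_derivation[of x y w' w'] by (simp add: w')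
  have c1: "sg w w (sg w w' v) + sg w w' (sg w w v) = 0"
  proof -
    have "sg x y (sg w w (sg w w v)) = smul 2 (sg w w (sg w w' v) + sg w w' (sg w w v))"
      by (simp add: ww v scale_right_distrib)
    with Z show ?thesis by simp
  qed
  have c2: "sg w w (sg w' w' v) + sg w' w' (sg w w v) + smul 4 (sg w w' (sg w w' v)) = 0"
  proof -
    have "sg x y (sg w w (sg w w' v) + sg w w' (sg w w v)) =
        sg w w (sg w' w' v) + sg w' w' (sg w w v) + (smul 2 (sg w w' (sg w w' v)) + smul 2 (sg w w' (sg w w' v)))"
      by (simp add: ww ww' v)
    also have "smul 2 (sg w w' (sg w w' v)) + smul 2 (sg w w' (sg w w' v)) = smul 4 (sg w w' (sg w w' v))"
      by (simp flip: scale_left_distrib)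
    finally show ?thesis by (simp add: c1)
  qed
  have c3: "sg w w' (sg w' w' v) + sg w' w' (sg w w' v) = 0"
  proof -
    have "sg x y (sg w w (sg w' w' v) + sg w' w' (sg w w v) + smul 4 (sg w w' (sg w w' v)))
        = (smul 2 (sg w w' (sg w' w' v)) + smul 4 (sg w w' (sg w' w' v)))
          + (smul 2 (sg w' w' (sg w w' v)) + smul 4 (sg w' w' (sg w w' v)))"
      by (simp add: ww ww' w'w' v scale_right_distrib)
    also have "\<dots> = smul 6 (sg w w' (sg w' w' v) + sg w' w' (sg w w' v))"
      by (simp add: scale_right_distrib flip: scale_left_distrib)
    finally show ?thesis by (simp add: c2)
  qed
  have c4: "sg w' w' (sg w' w' v) = 0"
  proof -
    have "sg x y (sg w w' (sg w' w' v) + sg w' w' (sg w w' v)) = smul 2 (sg w' w' (sg w' w' v))"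
      by (simp add: ww' w'w' v scale_left_distrib[of 1 1, simplified])
    then show ?thesis by (simp add: c3)
  qed
  have "X_sq_zero (w + 1 *s w') v"
    unfolding X_sq_expand by (simp only: Z c1 c2 c3 c4 scale_zero_right add_0_left add_0_right)
  then show ?thesis by (simp add: w'_def)
qed

text \<open>The lowest unit vector \<open>er o'\<close> is covered by the \<open>sl\<^sub>2\<close>-argument. A single unipotent element fixing \<open>v\<close>
  moves a multiple of it to any vector whose coordinate at \<open>Inr o'\<close> is nonzero, and for a vector
  \<open>w\<close> outside their range the square is the constant term of a polynomial in \<open>m\<close>, its value at \<open>w + m er o'\<close>,
  that vanishes for all \<open>m > 0\<close>.\<close>

lemma X_sq_zero_highest:
  assumes fin: "finite_dim smul"
    and pos: "\<And>j. sg (el j) (el o') v = 0" and minus: "\<And>j. j \<noteq> o' \<Longrightarrow> sg (el o') (er j) v = 0"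
    and H: "sg (el o') (er o') v = smul c v" and c: "c = 0 \<or> c = 1"
  shows "X_sq_zero w v"
proof -
  have generic: "X_sq_zero z v" if z: "z $ Inr o' \<noteq> 0" for z
  proof -
    define c where "c = z $ Inr o'"
    define y where "y = (- 1 / c) *s (z - c *s er o')"
    \<comment> \<open>the solution of \<open>x + x\<^sub>o\<^sub>' el o' = y\<close>, which makes \<open>symm x (el o')\<close> send \<open>c er o'\<close> to \<open>z - c er o'\<close>\<close>
    define x where "x = y - (y $ Inl o' / 2) *s el o'"
    have c0: "c \<noteq> 0" using z by (simp add: c_def)
    have yo: "y $ Inr o' = 0" by (simp add: y_def c_def axis_def)
    then have xo: "x $ Inr o' = 0" by (simp add: x_def axis_def)
    have xl: "x $ Inl o' = y $ Inl o' / 2" by (simp add: x_def axis_def)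
    have "sg x (el o') v = 0"
    proof -
      have "sg (\<Sum>a\<in>A. x $ a *s unit_vec a) (el o') v = (\<Sum>a\<in>A. smul (x $ a) (sg (unit_vec a) (el o') v))" for A
        by (induction A rule: infinite_finite_induct) auto
      from this[of UNIV] have "sg x (el o') v = (\<Sum>a\<in>UNIV. smul (x $ a) (sg (unit_vec a) (el o') v))"
        by (simp add: basis_expansion)
      also have "\<dots> = 0"
      proof (intro sum.neutral ballI)
        fix a :: "'n + 'n"
        show "smul (x $ a) (sg (unit_vec a) (el o') v) = 0"
          using xo pos minus by (cases a) (auto simp: sg_commute[of "er _"], metis)
      qed
      finally show ?thesis .
    qed
    moreover have "omega x (el o') = 0"
      using xo by (simp add: omega_unit_vec)
    moreover have "X_sq_zero (c *s er o') v"
      using X_sq_zero_lowest[OF fin pos H \<open>_ \<or> _\<close>] by simp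
    ultimately have "X_sq_zero (c *s er o' + (omega (el o') (c *s er o') *s x + omega x (c *s er o') *s el o')) v"
      by (intro X_sq_zero_unipotent)
    also have "c *s er o' + (omega (el o') (c *s er o') *s x + omega x (c *s er o') *s el o')
        = c *s er o' - c *s (x + x $ Inl o' *s el o')"
      by (simp add: omega_unit_vec(4) vec.scale_right_distrib)
    also have "x + x $ Inl o' *s el o' = y"
      unfolding xl unfolding x_def by (simp add: vec_eq_iff axis_def)
    also have "c *s er o' - c *s y = z"
      using c0 by (simp add: y_def vec_eq_iff)
    finally show ?thesis .
  qed
  show ?thesis
  proof (cases "w $ Inr o' = 0")
    case True
    have "X_sq_zero (w + of_nat m *s er o') v" if "m > 0" for m :: nat
      by (rule generic) (use that True in \<open>simp add: axis_def\<close>)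
    from polarized_X_sq(1)[OF this] show ?thesis by simp
  qed (rule generic)
qed

end

section \<open>Fundamental weights\<close>

lemma position_Min_greater:
  assumes "j \<noteq> Max (UNIV :: 'n::{finite,linorder} set)"
  shows "position (Min {i. j < i}) = Suc (position j)"
proof -
  have "j < Max UNIV" using assms Max_ge[of UNIV j] by (simp add: order_less_le)
  then have ne: "{i. j < i} \<noteq> {}" by blast
  define s where "s = Min {i. j < i}"
  have "j < s" using Min_in[OF _ ne] by (simp add: s_def)
  moreover have "s \<le> i" if "j < i" for i using that by (simp add: s_def)
  ultimately have "{..s} = insert s {..j}" by (auto simp: not_le[symmetric] intro: ccontr) force
  then show ?thesis unfolding position_def s_def[symmetric] using \<open>j < s\<close> by simp
qed

lemma position_le: "position (j :: 'n::{finite,linorder}) \<le> CARD('n)"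
  unfolding position_def by (rule card_mono) auto

lemma position_Max: "position (Max UNIV :: 'n::{finite,linorder}) = CARD('n)"
proof -
  have "{..Max UNIV :: 'n} = UNIV" by auto
  then show ?thesis by (simp add: position_def)
qed

lemma sp_h_cartan: "sp_h i \<in> cartan" "- sp_h i \<in> cartan" "mat_scale c (sp_h i) \<in> cartan"
proof -
  interpret M: vector_space "mat_scale :: complex \<Rightarrow> 'a cmat \<Rightarrow> 'a cmat"
    by (rule vector_space_mat_scale)
  show "sp_h i \<in> cartan" "- sp_h i \<in> cartan" "mat_scale c (sp_h i) \<in> cartan"
    unfolding cartan_def by (auto intro: M.span_base M.span_neg M.span_scale)
qed

lemma cartan_subset_sp: "x \<in> cartan \<Longrightarrow> x \<in> sp"
proof -
  interpret M: vector_space "mat_scale :: complex \<Rightarrow> 'a cmat \<Rightarrow> 'a cmat"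
    by (rule vector_space_mat_scale)
  have "cartan \<subseteq> (sp :: 'a cmat set)" unfolding cartan_def sp_def by (intro M.span_mono) auto
  then show "x \<in> cartan \<Longrightarrow> x \<in> sp" by blast
qed

lemma cartan_induct [consumes 1, case_names zero step]:
  assumes "x \<in> cartan" and "P 0"
    and "\<And>c i y. y \<in> cartan \<Longrightarrow> P y \<Longrightarrow> P (mat_scale c (sp_h i) + y)"
  shows "P (x :: 'n::finite cmat)"
proof -
  interpret M: vector_space "mat_scale :: complex \<Rightarrow> 'n cmat \<Rightarrow> 'n cmat"
    by (rule vector_space_mat_scale)
  from assms(1) have "x \<in> cartan \<and> P x"
    unfolding cartan_def
  proof (induction rule: M.span_induct_alt)
    case (step c x y)
    then show ?case
      using assms(3)[unfolded cartan_def] by (auto intro: M.span_base M.span_scale M.span_add)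
  qed (simp add: assms(2) M.span_zero)
  then show ?thesis ..
qed

lemma is_weight_scale: "is_weight \<mu> \<Longrightarrow> x \<in> cartan \<Longrightarrow> \<mu> (mat_scale c x) = c * \<mu> x"
  unfolding is_weight_def by blast

lemma is_weight_diff:
  assumes "is_weight \<mu>"
  shows "\<mu> (sp_h i - sp_h j) = \<mu> (sp_h i) - \<mu> (sp_h j)"
proof -
  have "- sp_h j = mat_scale (-1) (sp_h j)" by (simp add: mat_scale_def vec_eq_iff)
  then have "\<mu> (- sp_h j) = - \<mu> (sp_h j)"
    using is_weight_scale[OF assms sp_h_cartan(1)] by simp
  moreover have "\<mu> (sp_h i + - sp_h j) = \<mu> (sp_h i) + \<mu> (- sp_h j)"
    using assms sp_h_cartan unfolding is_weight_def by blast
  ultimately show ?thesis by simp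
qed

text \<open>In other words \<open>\<delta>\<^sub>k = \<epsilon>\<^sub>1 + \<dots> + \<epsilon>\<^sub>k\<close>: the values on the \<open>h\<^sub>i\<close> are recovered from those on the coroots
  by going down from the last index.\<close>

lemma is_fundamental_weight_iff:
  fixes \<mu> :: "'n::{finite,linorder} cmat \<Rightarrow> complex"
  assumes "k \<le> CARD('n)" and w: "is_weight \<mu>"
  shows "is_fundamental_weight k \<mu> \<longleftrightarrow> (\<forall>j. \<mu> (sp_h j) = (if position j \<le> k then 1 else 0))"
proof (cases "k = 0")
  case True
  have pos: "position j \<noteq> 0" for j :: 'n by (auto simp: position_def)
  have "\<mu> x = 0" if "\<And>j. \<mu> (sp_h j) = 0" and x: "x \<in> cartan" for x
    using x
  proof (induction rule: cartan_induct)
    case zero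
    show ?case using is_weight_scale[OF w sp_h_cartan(1), of 0 "Min UNIV"]
      by (simp add: mat_scale_def zero_vec_def)
  next
    case (step c i y)
    then have "\<mu> (mat_scale c (sp_h i) + y) = \<mu> (mat_scale c (sp_h i)) + \<mu> y"
      using w sp_h_cartan(3) unfolding is_weight_def by blast
    then show ?case using is_weight_scale[OF w sp_h_cartan(1)] step that(1) by simp
  qed
  then have "(\<forall>x\<in>cartan. \<mu> x = 0) \<longleftrightarrow> (\<forall>j. \<mu> (sp_h j) = 0)"
    using sp_h_cartan(1) by metis
  then show ?thesis using True w by (simp add: is_fundamental_weight_def pos[unfolded neq0_conv] pos)
next
  case False
  have coroot: "\<mu> (coroot j) = (if j = Max UNIV then \<mu> (sp_h j) else \<mu> (sp_h j) - \<mu> (sp_h (Min {i. j < i})))" for j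
    by (simp add: coroot_def is_weight_diff[OF w])
  show ?thesis
  proof
    assume "is_fundamental_weight k \<mu>"
    then have f: "\<mu> (coroot j) = (if position j = k then 1 else 0)" for j
      using False by (simp add: is_fundamental_weight_def)
    have "\<mu> (sp_h j) = (if position j \<le> k then 1 else 0)" for j
    proof (induction "CARD('n) - position j" arbitrary: j rule: less_induct)
      case less
      show ?case
      proof (cases "j = Max UNIV")
        case True
        then show ?thesis using coroot[of j] f[of j] assms(1) by (simp add: position_Max)
      next
        case ne: False
        have "\<mu> (sp_h (Min {i. j < i})) = (if position (Min {i. j < i}) \<le> k then 1 else 0)"
          using position_Min_greater[OF ne] position_le[of "Min {i. j < i}"] by (intro less) linarith
        then show ?thesis using coroot[of j] f[of j] ne by (auto simp: position_Min_greater split: if_splits)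
      qed
    qed
    then show "\<forall>j. \<mu> (sp_h j) = (if position j \<le> k then 1 else 0)" by blast
  next
    assume "\<forall>j. \<mu> (sp_h j) = (if position j \<le> k then 1 else 0)"
    then show "is_fundamental_weight k \<mu>"
      using False w assms(1) coroot
      by (auto simp: is_fundamental_weight_def position_Min_greater position_Max)
  qed
qed

text \<open>On the highest weight vector, \<open>h\<^sub>1\<close> acts by \<open>0\<close> or \<open>1\<close>, so that the square of the root vector for
  \<open>-2 \<epsilon>\<^sub>1\<close> kills it.\<close>

lemma (in sp_module) X_sq_zero_of_V_delta:
  assumes V: "is_V_delta k smul act" and k: "k \<le> CARD('n)"
  shows "X_sq_zero w v"
proof -
  from V have fin: "finite_dim smul" and irr: "irreducible_sp_module smul act"
    by (auto simp: is_V_delta_def)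
  interpret irreducible_lie_module sp mat_scale mat_bracket smul act by (rule irr)
  from V obtain \<mu> v0 where \<mu>: "is_fundamental_weight k \<mu>" and v0: "highest_weight_vector smul act \<mu> v0"
    by (auto simp: is_V_delta_def)
  define o' where "o' = (Min UNIV :: 'n)"
  have less: "o' < j" if "j \<noteq> o'" for j using that by (simp add: o'_def order_less_le)
  have le: "o' \<le> j" for j by (simp add: o'_def)
  have w: "is_weight \<mu>" using \<mu> by (simp add: is_fundamental_weight_def)
  have "X_sq_zero w v0" for w
  proof (rule X_sq_zero_highest[OF fin])
    show "sg (el j) (el o') v0 = 0" for j
      using v0 le[of j] act_X_root(2)[of o' j v0] by (simp add: highest_weight_vector_def sg_commute)
    show "sg (el o') (er j) v0 = 0" if "j \<noteq> o'" for j
      using v0 less[OF that] act_X_root(1)[of o' j v0] by (simp add: highest_weight_vector_def)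
    show "sg (el o') (er o') v0 = smul (\<mu> (sp_h o')) v0"
      using v0 sp_h_cartan(1)[of o'] by (simp add: highest_weight_vector_def flip: act_X_root(4))
    show "\<mu> (sp_h o') = 0 \<or> \<mu> (sp_h o') = 1"
      using \<mu> unfolding is_fundamental_weight_iff[OF k w] by simp
  qed
  then have "v0 \<in> {v. \<forall>p\<in>UNIV. X_sq_zero p v}" by simp
  moreover have "submodule {v. \<forall>p\<in>UNIV. X_sq_zero p v}"
    by (rule submodule_X_sq_kernel) auto
  moreover have "v0 \<noteq> 0" using v0 by (simp add: highest_weight_vector_def)
  ultimately show ?thesis using simple[of "{v. \<forall>p\<in>UNIV. X_sq_zero p v}"] by blast
qed

section \<open>Modules on which every square vanishes\<close>

lemma (in complex_space) eq_smul_if_eq_minus: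
  assumes "x = - x + smul (2 * c) y"
  shows "x = smul c y"
proof -
  have "x + x = x + (- x + smul (2 * c) y)" using assms by (rule arg_cong)
  then have "smul 2 x = smul (2 * c) y" unfolding double by simp
  then have "smul (1 / 2) (smul 2 x) = smul (1 / 2) (smul (2 * c) y)" by (rule arg_cong)
  then show ?thesis by simp
qed

text \<open>The squares are assumed to vanish only for integral vectors, the indices of the \<open>h\<^sub>r\<close>, because this is
  the negation of what \<open>F_irreducible_if_nonzero_square\<close> needs.\<close>

locale square_zero_module = sp_module smul act + irreducible_lie_module sp mat_scale mat_bracket smul act
  for smul :: "complex \<Rightarrow> 'v::ab_group_add \<Rightarrow> 'v"
    and act :: "'n::{finite,linorder} cmat \<Rightarrow> 'v \<Rightarrow> 'v" +
  assumes X_sq_zero_integral: "X_sq_zero (cvec p) v"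
begin

lemma X_sq_zero_line: "X_sq_zero (unit_vec a + of_nat m *s unit_vec b) v"
proof -
  have "unit_vec a + of_nat m *s unit_vec b = cvec (axis a 1 + of_nat m *s axis b 1)"
    by (auto simp: cvec_def axis_def vec_eq_iff)
  then show ?thesis by (simp add: X_sq_zero_integral del: sg_add_left sg_add_mid)
qed

text \<open>With \<open>A = sg a a\<close>, \<open>B = sg b b\<close>, \<open>S = sg a b\<close> and \<open>\<omega> = \<omega>(a, b)\<close> for unit vectors \<open>a\<close> and \<open>b\<close>, the
  commutators and the polarized squares combine to \<open>S A = -\<omega> A\<close>, \<open>S B = \<omega> B\<close>, \<open>A B - B A = 4\<omega> S\<close> and
  \<open>4 S\<^sup>2 = -(A B + B A)\<close>.\<close>

lemma sg_cube:
  "sg (unit_vec a) (unit_vec b) (sg (unit_vec a) (unit_vec b) (sg (unit_vec a) (unit_vec b) v))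
    = smul (omega (unit_vec a) (unit_vec b) ^ 2) (sg (unit_vec a) (unit_vec b) v)"
proof -
  let ?A = "sg (unit_vec a) (unit_vec a)" and ?B = "sg (unit_vec b) (unit_vec b)"
    and ?S = "sg (unit_vec a) (unit_vec b)" and ?o = "omega (unit_vec a) (unit_vec b)"
  have skew: "omega (unit_vec b) (unit_vec a) = - ?o" by (rule omega_skew)
  note pa = polarized_X_sq(2)[OF X_sq_zero_line[of a _ b]]
  note pb = polarized_X_sq(2)[OF X_sq_zero_line[of b _ a]]
  have SA: "?S (?A u) = smul (- ?o) (?A u)" for u
  proof -
    have "?S (?A u) = ?A (?S u) - smul (2 * ?o) (?A u)"
      by (subst sg_swap) (simp add: skew sg_commute scale_left_distrib[symmetric])
    moreover have "?A (?S u) = - ?S (?A u)" using pa[of u] by (simp add: eq_neg_iff_add_eq_0)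
    ultimately have "?S (?A u) = - ?S (?A u) + smul (2 * (- ?o)) (?A u)" by simp
    then show ?thesis by (rule eq_smul_if_eq_minus)
  qed
  have SB: "?S (?B u) = smul ?o (?B u)" for u
  proof -
    have "?S (?B u) = ?B (?S u) + smul (2 * ?o) (?B u)"
      by (subst sg_swap) (simp add: sg_commute[of "unit_vec b" "unit_vec a"] double)
    moreover have "?B (?S u) = - ?S (?B u)"
      using pb[of u] by (simp add: eq_neg_iff_add_eq_0 sg_commute[of "unit_vec b" "unit_vec a"])
    ultimately have "?S (?B u) = - ?S (?B u) + smul (2 * ?o) (?B u)" by simp
    then show ?thesis by (rule eq_smul_if_eq_minus)
  qed
  have AB: "?A (?B u) = ?B (?A u) + smul (4 * ?o) (?S u)" for u
  proof -
    have "smul (4 * ?o) (?S u) = (smul ?o (?S u) + smul ?o (?S u)) + (smul ?o (?S u) + smul ?o (?S u))"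
      unfolding double by simp
    then show ?thesis by (subst sg_swap) simp
  qed
  have "smul 4 (?S (?S (?S v))) = ?S (smul 4 (?S (?S v)))" by simp
  also have "\<dots> = - (?S (?A (?B v)) + ?S (?B (?A v)))"
    unfolding polarized_X_sq(3)[OF X_sq_zero_line] by simp
  also have "\<dots> = smul ?o (?A (?B v) - ?B (?A v))"
    unfolding SA SB by (simp add: scale_right_diff_distrib)
  also have "\<dots> = smul 4 (smul (?o ^ 2) (?S v))"
    unfolding AB by (simp add: power2_eq_square mult.left_commute)
  finally show ?thesis unfolding scale_cancel_left by simp
qed

text \<open>Words in the generators \<open>sg (unit_vec a) (unit_vec b)\<close>, applied to a vector. Modulo shorter words
  any letter may be moved to the front, so a word with three equal letters is a combination of shorter
  words by \<open>sg_cube\<close>. This bounds the length of the words that are needed.\<close>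

fun word :: "(('n + 'n) \<times> ('n + 'n)) list \<Rightarrow> 'v \<Rightarrow> 'v" where
  "word [] v = v"
| "word ((a, b) # xs) v = sg (unit_vec a) (unit_vec b) (word xs v)"

definition word_span :: "'v \<Rightarrow> nat \<Rightarrow> 'v set" where
  "word_span v d = span {word xs v |xs. length xs \<le> d}"

lemma subspace_word_span: "subspace (word_span v d)"
  by (simp add: word_span_def)

lemma word_in_word_span: "length xs \<le> d \<Longrightarrow> word xs v \<in> word_span v d"
  unfolding word_span_def by (rule span_base) blast

lemma sg_word_span:
  assumes "u \<in> word_span v d"
  shows "sg (unit_vec a) (unit_vec b) u \<in> word_span v (Suc d)"
  using assms[unfolded word_span_def]
proof (induction rule: span_induct_alt)
  case base
  show ?case using subspace_0[OF subspace_word_span] by simp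
next
  case (step c x y)
  then obtain xs where "x = word xs v" "length xs \<le> d" by blast
  then have "sg (unit_vec a) (unit_vec b) x \<in> word_span v (Suc d)"
    using word_in_word_span[of "(a, b) # xs" "Suc d" v] by simp
  with step show ?case
    by (simp add: subspace_add[OF subspace_word_span] subspace_scale[OF subspace_word_span])
qed

lemma word_move_to_front:
  "word (xs @ x # ys) v - word (x # xs @ ys) v \<in> word_span v (length xs + length ys)"
proof (induction xs)
  case Nil
  show ?case using subspace_0[OF subspace_word_span] by simp
next
  case (Cons z xs)
  obtain a b c d where z: "z = (a, b)" and x: "x = (c, d)" by (metis surj_pair)
  let ?z = "sg (unit_vec a) (unit_vec b)" and ?x = "sg (unit_vec c) (unit_vec d)"
  let ?u = "word (xs @ ys) v"
  have in_span: "sg (unit_vec e) (unit_vec f) ?u \<in> word_span v (length (z # xs) + length ys)" for e f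
    using sg_word_span[OF word_in_word_span[of "xs @ ys" "length xs + length ys" v], of e f] by simp
  have "word ((z # xs) @ x # ys) v - word (x # (z # xs) @ ys) v
      = ?z (word (xs @ x # ys) v - word (x # xs @ ys) v) + (?z (?x ?u) - ?x (?z ?u))"
    by (simp add: z x)
  also have "?z (?x ?u) - ?x (?z ?u) \<in> word_span v (length (z # xs) + length ys)"
    by (subst sg_swap)
      (simp add: in_span[simplified] subspace_add[OF subspace_word_span] subspace_scale[OF subspace_word_span])
  then have "?z (word (xs @ x # ys) v - word (x # xs @ ys) v) + (?z (?x ?u) - ?x (?z ?u))
      \<in> word_span v (length (z # xs) + length ys)"
    using sg_word_span[OF Cons, of a b] by (intro subspace_add[OF subspace_word_span]) auto
  finally show ?case .
qed

lemma word_extract: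
  assumes "x \<in> set xs"
  obtains ys where "length xs = Suc (length ys)" "count_list xs x = Suc (count_list ys x)"
    "word xs v - word (x # ys) v \<in> word_span v (length ys)"
proof -
  from assms obtain as bs where xs: "xs = as @ x # bs" by (meson split_list)
  show ?thesis
    by (rule that[of "as @ bs"]) (use word_move_to_front[of as x bs v] in \<open>simp_all add: xs\<close>)
qed

lemma word_reduce:
  assumes "count_list xs x \<ge> 3"
  shows "word xs v \<in> word_span v (length xs - 1)"
proof -
  obtain a b where x: "x = (a, b)" by (metis surj_pair)
  let ?x = "sg (unit_vec a) (unit_vec b)"
  have "x \<in> set xs" using assms by (metis count_notin not_numeral_le_zero)
  then obtain ys where ys: "length xs = Suc (length ys)" "count_list xs x = Suc (count_list ys x)"
    "word xs v - word (x # ys) v \<in> word_span v (length ys)" by (rule word_extract)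
  have "x \<in> set ys" using assms ys by (metis count_notin Suc_le_mono numeral_3_eq_3 not_less_eq_eq zero_le)
  then obtain zs where zs: "length ys = Suc (length zs)" "count_list ys x = Suc (count_list zs x)"
    "word ys v - word (x # zs) v \<in> word_span v (length zs)" by (rule word_extract)
  have "x \<in> set zs" using assms ys zs by (metis count_notin Suc_le_mono numeral_3_eq_3 not_less_eq_eq zero_le)
  then obtain us where us: "length zs = Suc (length us)" "count_list zs x = Suc (count_list us x)"
    "word zs v - word (x # us) v \<in> word_span v (length us)" by (rule word_extract)
  have 1: "?x (word ys v - word (x # zs) v) \<in> word_span v (length ys)"
    using sg_word_span[OF zs(3)] zs(1) by simp
  have 2: "?x (?x (word zs v - word (x # us) v)) \<in> word_span v (length ys)"
    using sg_word_span[OF sg_word_span[OF us(3)]] zs(1) us(1) by simp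
  have "smul (omega (unit_vec a) (unit_vec b) ^ 2) (word (x # us) v) \<in> word_span v (length ys)"
    using zs(1) us(1) by (intro subspace_scale[OF subspace_word_span] word_in_word_span) simp
  then have 3: "?x (?x (word (x # us) v)) \<in> word_span v (length ys)"
    by (simp add: x sg_cube)
  have "word xs v = (word xs v - word (x # ys) v) + ?x (word ys v - word (x # zs) v)
      + ?x (?x (word zs v - word (x # us) v)) + ?x (?x (word (x # us) v))"
    by (simp add: x)
  also have "\<dots> \<in> word_span v (length ys)"
    by (intro subspace_add[OF subspace_word_span] 1 2 3 ys(3))
  finally show ?thesis by (simp add: ys(1))
qed

text \<open>A word longer than twice the number of letters contains some letter three times.\<close>

lemma finite_dimensional: "finite_dim smul"
proof -
  from nonzero obtain v :: 'v where v: "v \<noteq> 0" by blast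
  define d where "d = 2 * CARD(('n + 'n) \<times> ('n + 'n))"
  have all: "word xs v \<in> word_span v d" for xs
  proof (induction "length xs" arbitrary: xs rule: less_induct)
    case less
    show ?case
    proof (cases "length xs \<le> d")
      case True
      then show ?thesis by (rule word_in_word_span)
    next
      case False
      have "\<exists>x. count_list xs x \<ge> 3"
      proof (rule ccontr)
        assume "\<nexists>x. count_list xs x \<ge> 3"
        then have "count_list xs x \<le> 2" for x by (metis not_less_eq_eq numeral_2_eq_2 numeral_3_eq_3)
        then have "sum (count_list xs) UNIV \<le> (\<Sum>x\<in>(UNIV :: (('n + 'n) \<times> ('n + 'n)) set). 2)"
          by (intro sum_mono)
        moreover have "sum (count_list xs) UNIV = length xs"
          by (rule sum_count_set) auto
        ultimately show False using False by (simp add: d_def)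
      qed
      then have "word xs v \<in> word_span v (length xs - 1)" using word_reduce by blast
      moreover have "word_span v (length xs - 1) \<subseteq> word_span v d"
        unfolding word_span_def[of v "length xs - 1"]
        by (rule span_minimal[OF _ subspace_word_span]) (use less False in auto)
      ultimately show ?thesis by blast
    qed
  qed
  have mem: "sg (unit_vec a) (unit_vec b) u \<in> word_span v d" if "u \<in> word_span v d" for a b u
  proof -
    have "word_span v (Suc d) \<subseteq> word_span v d"
      unfolding word_span_def[of v "Suc d"]
      by (rule span_minimal[OF _ subspace_word_span]) (use all in auto)
    with sg_word_span[OF that] show ?thesis by blast
  qed
  have "submodule (word_span v d)"
    by (simp add: submodule_iff_sg subspace_word_span mem)
  then have "word_span v d = UNIV"
    using simple[of "word_span v d"] all[of "[]"] v by auto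
  moreover have "{word xs v |xs. length xs \<le> d} = (\<lambda>xs. word xs v) ` {xs. set xs \<subseteq> UNIV \<and> length xs \<le> d}"
    by auto
  then have "finite {word xs v |xs. length xs \<le> d}"
    by (simp only: finite_imageI finite_lists_length_le[OF finite_class.finite_UNIV])
  ultimately show ?thesis unfolding finite_dim_def word_span_def by blast
qed

lemma weight_bounded:
  assumes "weight_vector m v"
  shows "m i \<in> {-1, 0, 1}"
proof -
  have *: "sg (el i) (er i) v = smul (of_int (m i)) v" "v \<noteq> 0"
    using assms by (auto simp: weight_vector_def)
  have "smul (of_int (m i ^ 3 - m i)) v = 0"
    using sg_cube[of "Inl i" "Inr i" v] by (simp add: * power3_eq_cube scale_left_diff_distrib mult.assoc)
  then have "m i ^ 3 - m i = 0" using *(2) unfolding scale_eq_0_iff of_int_eq_0_iff by blast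
  then have "m i * (m i - 1) * (m i + 1) = 0" by (simp add: algebra_simps power3_eq_cube)
  then show ?thesis by (auto simp: eq_neg_iff_add_eq_0)
qed

text \<open>The operators \<open>H\<^sub>i\<close> commute and satisfy \<open>H\<^sub>i\<^sup>3 = H\<^sub>i\<close>, so one of \<open>v\<close>, \<open>H\<^sub>i v\<close> and \<open>H\<^sub>i\<^sup>2 v + H\<^sub>i v\<close> is an
  eigenvector of \<open>H\<^sub>i\<close>, and it inherits the other eigenvalues of \<open>v\<close>.\<close>

lemma weight_vector_exists: "\<exists>m v. weight_vector m v"
proof -
  let ?H = "\<lambda>i. sg (el i) (er i)"
  have comm: "?H i (?H j v) = ?H j (?H i v)" for i j v
    by (cases "i = j") (auto simp: sg_swap[of "el i" "er i" "el j" "er j"])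
  have "\<exists>v. v \<noteq> 0 \<and> (\<forall>i\<in>A. \<exists>c::int. ?H i v = smul (of_int c) v)" for A
  proof (induction A rule: finite_induct[OF finite])
    case 1
    then show ?case using nonzero by auto
  next
    case (2 i A)
    then obtain v where v: "v \<noteq> 0" "\<And>j. j \<in> A \<Longrightarrow> \<exists>c::int. ?H j v = smul (of_int c) v" by blast
    have cube: "?H i (?H i (?H i v)) = ?H i v" using sg_cube[of "Inl i" "Inr i" v] by simp
    have H: "\<exists>c::int. ?H j (?H i v) = smul (of_int c) (?H i v)" if "j \<in> A" for j
      using v(2)[OF that] by (auto simp: comm[of j])
    have HH: "\<exists>c::int. ?H j (?H i (?H i v) + ?H i v) = smul (of_int c) (?H i (?H i v) + ?H i v)" if "j \<in> A" for j
      using v(2)[OF that] by (auto simp: comm[of j] scale_right_distrib)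
    consider "?H i v = 0" | "?H i v \<noteq> 0" "?H i (?H i v) + ?H i v = 0" | "?H i (?H i v) + ?H i v \<noteq> 0" by blast
    then show ?case
    proof cases
      case 1
      then have "?H i v = smul (of_int 0) v" by simp
      with v show ?thesis by blast
    next
      case 2
      then have "?H i (?H i v) = smul (of_int (- 1)) (?H i v)" by (simp add: eq_neg_iff_add_eq_0)
      with 2(1) H show ?thesis by blast
    next
      case 3
      have "?H i (?H i (?H i v) + ?H i v) = smul (of_int 1) (?H i (?H i v) + ?H i v)"
        by (simp add: cube add.commute)
      with 3 HH show ?thesis by blast
    qed
  qed
  from this[of UNIV] obtain v where v: "v \<noteq> 0" "\<forall>i. \<exists>c::int. ?H i v = smul (of_int c) v" by auto
  then obtain m where "\<And>i. ?H i v = smul (of_int (m i)) v" by metis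
  with v(1) show ?thesis by (auto simp: weight_vector_def)
qed

text \<open>There are finitely many weights; one that maximizes a functional positive on all positive roots is
  highest.\<close>

lemma highest_weight_exists:
  obtains m v where "weight_vector m v" "\<And>i j. i < j \<Longrightarrow> sg (el i) (er j) v = 0"
    "\<And>i j. sg (el i) (el j) v = 0"
proof -
  \<comment> \<open>positive and strictly decreasing in \<open>i\<close>, so \<open>f\<close> is positive on \<open>\<epsilon>\<^sub>i - \<epsilon>\<^sub>j\<close> for \<open>i < j\<close> and on \<open>\<epsilon>\<^sub>k + \<epsilon>\<^sub>l\<close>\<close>
  define c where "c i = int (card {i..})" for i :: 'n
  define f where "f m = (\<Sum>i\<in>UNIV. m i * c i)" for m :: "'n \<Rightarrow> int"
  let ?W = "{m. \<exists>v. weight_vector m v}"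
  have "?W \<subseteq> PiE UNIV (\<lambda>_. {-1, 0, 1})" using weight_bounded by (auto simp: PiE_def)
  then have "finite ?W" by (rule finite_subset) (auto intro: finite_PiE)
  moreover have "?W \<noteq> {}" using weight_vector_exists by auto
  ultimately have "Max (f ` ?W) \<in> f ` ?W" by (intro Max_in) auto
  then obtain m where m: "m \<in> ?W" and fm: "f m = Max (f ` ?W)" by (metis (no_types, lifting) imageE)
  have max: "f m' \<le> f m" if "m' \<in> ?W" for m'
    unfolding fm using \<open>finite ?W\<close> that by (intro Max_ge) auto
  from m obtain v where v: "weight_vector m v" by blast
  define cc where "cc a = (case a of Inl i \<Rightarrow> c i | Inr i \<Rightarrow> - c i)" for a
  have fa: "(\<Sum>i\<in>UNIV. unit_weight a i * c i) = cc a" for a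
    by (cases a) (simp_all add: cc_def if_distrib[of "\<lambda>x. x * _"] cong: if_cong)
  have kill: "sg (unit_vec a) (unit_vec b) v = 0" if "cc a + cc b > 0" for a b
  proof (rule ccontr)
    assume "sg (unit_vec a) (unit_vec b) v \<noteq> 0"
    from max[OF CollectI, OF exI, OF sg_weight_shift[OF v this]]
    have "f (\<lambda>i. m i + unit_weight a i + unit_weight b i) \<le> f m" .
    also have "f (\<lambda>i. m i + unit_weight a i + unit_weight b i) = f m + cc a + cc b"
      by (simp add: f_def distrib_right sum.distrib fa)
    finally show False using that by simp
  qed
  have pos: "c i > 0" for i by (auto simp: c_def card_gt_0_iff)
  have less: "c j < c i" if "i < j" for i j
    unfolding c_def of_nat_less_iff by (rule psubset_card_mono) (use that in auto)
  show ?thesis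
  proof (rule that[OF v])
    show "sg (el i) (er j) v = 0" if "i < j" for i j
      by (rule kill) (use less[OF that] in \<open>simp add: cc_def\<close>)
    show "sg (el i) (el j) v = 0" for i j
      by (rule kill) (use pos[of i] pos[of j] in \<open>simp add: cc_def\<close>)
  qed
qed

text \<open>The highest weight is bounded by \<open>1\<close> in absolute value. A coordinate \<open>-1\<close> contradicts \<open>F\<^sup>2 = 0\<close> for the
  root vector \<open>F\<close> of \<open>-2 \<epsilon>\<^sub>i\<close>. For \<open>i < j\<close> with coordinates \<open>0\<close> and \<open>1\<close>, the lowering operator of
  \<open>\<epsilon>\<^sub>j - \<epsilon>\<^sub>i\<close> would lead to a weight with coordinate \<open>2\<close>, so it kills the highest weight vector, against
  the commutator with its raising partner. Hence the ones precede the zeros.\<close>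

lemma fundamental: "\<exists>k\<le>CARD('n). is_V_delta k smul act"
proof -
  from highest_weight_exists obtain m v where v: "weight_vector m v"
    and minus: "\<And>i j. i < j \<Longrightarrow> sg (el i) (er j) v = 0" and plus: "\<And>i j. sg (el i) (el j) v = 0"
    by blast
  have H: "sg (el i) (er i) v = smul (of_int (m i)) v" and nz: "v \<noteq> 0" for i
    using v by (auto simp: weight_vector_def)
  have m01: "m i \<in> {0, 1}" for i
  proof (rule ccontr)
    assume "m i \<notin> {0, 1}"
    with weight_bounded[OF v, of i] have mi: "m i = -1" by simp
    let ?F = "sg (er i) (er i)" and ?E = "sg (el i) (el i)"
    note EF = sg_raise_lower[of i]
    have HF: "sg (el i) (er i) (?F v) = smul (-3) (?F v)"
    proof -
      have "sg (el i) (er i) (?F v) = - (?F v + ?F v + ?F v)"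
        by (subst sg_swap) (simp add: H mi sg_commute[of "er i" "el i"])
      also have "?F v + ?F v + ?F v = smul 3 (?F v)"
        using scale_left_distrib[of 2 1 "?F v"] by (simp add: double)
      finally show ?thesis by simp
    qed
    have "?F (?F v) = 0" using X_sq_zero_integral[of "axis (Inr i) 1"] by (simp add: cvec_axis)
    then have "?E (?F (?F v)) = 0" by simp
    then have "smul 16 (?F v) = 0"
      unfolding EF[of "?F v"] EF[of v] HF by (simp add: plus H mi flip: scale_left_distrib)
    then have "?F v = 0" by simp
    then have "?E (?F v) = 0" by simp
    then show False using nz by (simp add: EF plus H mi)
  qed
  have mono: "m j = 1 \<Longrightarrow> m i = 1" if "i < j" for i j
  proof (rule ccontr)
    assume mj: "m j = 1" and "m i \<noteq> 1"
    with m01[of i] have mi: "m i = 0" by simp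
    have "sg (el j) (er i) v = 0"
    proof (rule ccontr)
      assume "sg (el j) (er i) v \<noteq> 0"
      moreover have "j \<noteq> i" using that by simp
      ultimately show False using weight_bounded[OF sg_weight_shift[OF v], of "Inl j" "Inr i" j] mj by auto
    qed
    then have "sg (el i) (er j) (sg (el j) (er i) v) = 0" by simp
    then have "smul (of_int (m i)) v - smul (of_int (m j)) v = 0"
      using that by (subst (asm) sg_swap) (simp add: minus H sg_commute[of "er j" "el j"])
    then show False using nz by (simp add: mi mj)
  qed
  define k where "k = card {i. m i = 1}"
  have k: "k \<le> CARD('n)" unfolding k_def by (rule card_mono) auto
  have mk: "m i = (if position i \<le> k then 1 else 0)" for i
  proof (cases "m i = 1")
    case True
    then have "{..i} \<subseteq> {i. m i = 1}" using mono by (auto simp: order_le_less)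
    then show ?thesis using True unfolding k_def position_def by (simp add: card_mono)
  next
    case False
    then have "{i. m i = 1} \<subset> {..i}" using mono by (auto simp: not_le[symmetric])
    then have "k < position i" unfolding k_def position_def by (intro psubset_card_mono) auto
    then show ?thesis using False m01[of i] by auto
  qed
  define \<mu> where "\<mu> x = (\<Sum>i\<in>UNIV. of_int (m i) * x $ Inl i $ Inl i)" for x :: "'n cmat"
  have w: "is_weight \<mu>"
    by (auto simp: is_weight_def \<mu>_def mat_scale_def distrib_left sum.distrib sum_distrib_left mult.left_commute)
  have \<mu>h: "\<mu> (sp_h i) = of_int (m i)" for i
    by (simp add: \<mu>_def sp_h_def E_def if_distrib[of "\<lambda>x. _ * x"] cong: if_cong)
  have fw: "is_fundamental_weight k \<mu>"
    unfolding is_fundamental_weight_iff[OF k w] by (simp add: \<mu>h mk)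
  have "act x v = smul (\<mu> x) v" if "x \<in> cartan" for x
    using that
  proof (induction rule: cartan_induct)
    case zero
    show ?case by (simp add: act_zero \<mu>_def)
  next
    case (step c i y)
    then have "\<mu> (mat_scale c (sp_h i) + y) = \<mu> (mat_scale c (sp_h i)) + \<mu> y"
      using w sp_h_cartan(3) unfolding is_weight_def by blast
    then have "\<mu> (mat_scale c (sp_h i) + y) = c * of_int (m i) + \<mu> y"
      by (simp add: is_weight_scale[OF w sp_h_cartan(1)] \<mu>h)
    then show ?case using step
      by (simp add: act_add_left cartan_subset_sp sp_h_cartan act_scale_left X_in_sp act_X_root(4) H scale_left_distrib)
  qed
  then have "highest_weight_vector smul act \<mu> v"
    by (simp add: highest_weight_vector_def nz act_X_root minus plus)
  with fw k finite_dimensional irreducible_lie_module_axioms show ?thesis unfolding is_V_delta_def by blast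
qed

end

section \<open>The Shen-Larsson module\<close>

lemma ham_lookup:
  assumes "x \<in> ham" and "r \<noteq> 0"
  obtains c where "Poly_Mapping.lookup x r = c *s cvec (bar r)"
proof -
  interpret W: vector_space "witt_scale :: complex \<Rightarrow> ('a + 'a) witt \<Rightarrow> ('a + 'a) witt"
    by (rule vector_space_pm_scale[OF vec.vector_space_axioms])
  have "\<exists>c. Poly_Mapping.lookup x r = c *s cvec (bar r)"
    using assms(1)[unfolded ham_def]
  proof (induction rule: W.span_induct_alt)
    case base
    have "Poly_Mapping.lookup 0 r = 0 *s cvec (bar r)" by simp
    then show ?case by blast
  next
    case (step c x y)
    have "\<exists>a. Poly_Mapping.lookup x r = a *s cvec (bar r)"
    proof (cases "x = ham_h r")
      case True
      then have "Poly_Mapping.lookup x r = 1 *s cvec (bar r)"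
        by (simp add: ham_h_def D_def)
      then show ?thesis by blast
    next
      case False
      with step(1) assms(2) have "Poly_Mapping.lookup x r = 0 *s cvec (bar r)"
        by (auto simp: ham_h_def ham_d_def D_def lookup_single when_def)
      then show ?thesis by blast
    qed
    then obtain a where a: "Poly_Mapping.lookup x r = a *s cvec (bar r)" by blast
    from step(2) obtain b where b: "Poly_Mapping.lookup y r = b *s cvec (bar r)" by blast
    have "Poly_Mapping.lookup (witt_scale c x + y) r = (c * a + b) *s cvec (bar r)"
      by (simp add: lookup_add lookup_pm_scale[OF vec.vector_space_axioms] a b vec.scale_left_distrib)
    then show ?case by blast
  qed
  with that show ?thesis by blast
qed

lemma ham_closed:
  fixes x y :: "('n::finite + 'n) witt"
  shows "ham_h r \<in> (ham :: ('n + 'n) witt set)" "ham_d i \<in> (ham :: ('n + 'n) witt set)"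
    "0 \<in> (ham :: ('n + 'n) witt set)"
    "x \<in> ham \<Longrightarrow> witt_scale c x \<in> ham" "x \<in> ham \<Longrightarrow> y \<in> ham \<Longrightarrow> x + y \<in> ham"
proof -
  interpret W: vector_space "witt_scale :: complex \<Rightarrow> ('n + 'n) witt \<Rightarrow> ('n + 'n) witt"
    by (rule vector_space_pm_scale[OF vec.vector_space_axioms])
  have sub: "W.subspace ham" unfolding ham_def by (rule W.subspace_span)
  show "0 \<in> (ham :: ('n + 'n) witt set)" "x \<in> ham \<Longrightarrow> witt_scale c x \<in> ham"
    "x \<in> ham \<Longrightarrow> y \<in> ham \<Longrightarrow> x + y \<in> ham"
    using sub by (auto intro: W.subspace_0 W.subspace_scale W.subspace_add)
  have base: "x \<in> {ham_h r |r. r \<noteq> 0} \<union> range ham_d \<Longrightarrow> x \<in> ham" for x :: "('n + 'n) witt"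
    unfolding ham_def by (rule W.span_base)
  show "ham_d i \<in> (ham :: ('n + 'n) witt set)" by (rule base) blast
  show "ham_h r \<in> (ham :: ('n + 'n) witt set)"
  proof (cases "r = 0")
    case True
    then show ?thesis using W.subspace_0[OF sub] by (simp add: ham_h_0)
  next
    case False
    then show ?thesis by (intro base) blast
  qed
qed

lemma the_coefficient: "u \<noteq> 0 \<Longrightarrow> (THE c :: complex. b *s u = c *s u) = b"
  by (rule the_equality) auto

lemma witt_bracket_scale_left: "witt_bracket (witt_scale c x) y = witt_scale c (witt_bracket x y)"
proof -
  note vs = vec.vector_space_axioms
  interpret W: vector_space "witt_scale :: complex \<Rightarrow> 'a witt \<Rightarrow> 'a witt"
    by (rule vector_space_pm_scale[OF vec.vector_space_axioms])
  have D: "witt_scale c (Poly_Mapping.single r u) = D (c *s u) r" for c and r :: "int ^ 'a" and u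
    by (rule poly_mapping_eqI) (simp add: lookup_pm_scale[OF vs] D_def lookup_single when_def)
  have 0: "witt_bracket 0 y = 0" "witt_bracket y 0 = 0" for y :: "'a witt"
    by (simp_all add: witt_bracket_def)
  have scale: "witt_scale c (D u r) = D (c *s u) r" for c and r :: "int ^ 'a" and u
    by (simp add: D D_def[of u])
  show "witt_bracket (witt_scale c x) y = witt_scale c (witt_bracket x y)"
  proof (induction x rule: poly_mapping_add_induct)
    case (single r u)
    show ?case
      by (induction y rule: poly_mapping_add_induct)
        (simp_all add: 0 D witt_bracket_add_right W.scale_right_distrib flip: D_def,
          simp_all add: witt_bracket_D scale pair_scale_left vec.scale_right_diff_distrib mult.commute)
  qed (simp_all add: 0 witt_bracket_add_left W.scale_right_distrib)
qed

lemma witt_bracket_skew: "witt_bracket y x = - witt_bracket x y"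
proof -
  have 0: "witt_bracket 0 y = 0" "witt_bracket y 0 = 0" for y :: "'a witt"
    by (simp_all add: witt_bracket_def)
  show ?thesis
  proof (induction x rule: poly_mapping_add_induct)
    case (single r u)
    show ?case
    proof (induction y rule: poly_mapping_add_induct)
      case (single s v)
      show ?case unfolding D_def[symmetric] witt_bracket_D
        by (rule poly_mapping_eqI) (simp add: D_def lookup_single when_def add.commute)
    qed (simp_all add: 0 witt_bracket_add_left witt_bracket_add_right)
  qed (simp_all add: 0 witt_bracket_add_left witt_bracket_add_right)
qed

context sp_module
begin

text \<open>The action of \<open>h\<^sub>r\<close> on the fibre over \<open>s\<close>, where \<open>w = s + \<alpha>\<close>.\<close>

definition fibre_op :: "complex ^ ('n + 'n) \<Rightarrow> complex ^ ('n + 'n) \<Rightarrow> 'v \<Rightarrow> 'v" where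
  "fibre_op r w v = smul (omega r w) v + smul (1/2) (sg r r v)"

lemma fibre_op_add: "fibre_op r w (v + v') = fibre_op r w v + fibre_op r w v'"
  and fibre_op_scale: "fibre_op r w (smul c v) = smul c (fibre_op r w v)"
  by (simp_all add: fibre_op_def scale_right_distrib mult.commute add_ac)

lemma fibre_op_zero [simp]: "fibre_op r w 0 = 0" "fibre_op 0 w v = 0"
  by (simp_all add: fibre_op_def)

text \<open>The relation between \<open>h\<^sub>r\<close> and \<open>h\<^sub>s\<close>, read off in a single fibre.\<close>

lemma fibre_op_commutator:
  "fibre_op r (w + s) (fibre_op s w v) - fibre_op s (w + r) (fibre_op r w v) = smul (omega r s) (fibre_op (r + s) w v)"
proof -
  have skew: "omega s r = - omega r s" by (rule omega_skew)
  have "sg r r (sg s s v) = sg s s (sg r r v) + smul 4 (smul (omega r s) (sg r s v))"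
  proof -
    have "smul 4 (smul (omega r s) (sg r s v)) = (smul (omega r s) (sg r s v) + smul (omega r s) (sg r s v))
        + (smul (omega r s) (sg r s v) + smul (omega r s) (sg r s v))"
      unfolding double by simp
    then show ?thesis by (subst sg_swap) simp
  qed
  then have "fibre_op r (w + s) (fibre_op s w v) - fibre_op s (w + r) (fibre_op r w v)
    = smul ((omega r w + omega r s) * omega s w - (omega s w - omega r s) * omega r w) v
      + (smul ((omega r w + omega r s) / 2) (sg s s v) - smul (omega r w / 2) (sg s s v))
      + (smul (omega s w / 2) (sg r r v) - smul ((omega s w - omega r s) / 2) (sg r r v))
      + smul (omega r s) (sg r s v)"
    by (simp add: fibre_op_def skew scale_right_distrib scale_left_distrib scale_left_diff_distrib add_divide_distrib
      diff_divide_distrib mult.commute algebra_simps)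
  also have "\<dots> = smul (omega r s * (omega r w + omega s w)) v + smul (omega r s / 2) (sg s s v)
      + smul (omega r s / 2) (sg r r v) + smul (omega r s) (sg r s v)"
    unfolding scale_left_diff_distrib[symmetric] by (simp add: algebra_simps diff_divide_distrib add_divide_distrib)
  also have "\<dots> = smul (omega r s) (fibre_op (r + s) w v)"
  proof -
    have "smul (omega r s) (sg r s v) = smul (omega r s / 2) (sg r s v) + smul (omega r s / 2) (sg r s v)"
      by (simp flip: scale_left_distrib)
    then show ?thesis
      by (simp add: fibre_op_def sg_commute[of s r] scale_right_distrib)
  qed
  finally show ?thesis .
qed

end

locale shen_larsson = sp_module smul act
  for smul :: "complex \<Rightarrow> 'v::ab_group_add \<Rightarrow> 'v"
    and act :: "'n::{finite,linorder} cmat \<Rightarrow> 'v \<Rightarrow> 'v" +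
  fixes \<alpha> \<beta> :: "complex ^ ('n + 'n)"
begin

abbreviation "Fh \<equiv> F_h smul act \<alpha>"
abbreviation "Fd \<equiv> F_d smul \<beta>"
abbreviation "Fa \<equiv> F_act smul act \<alpha> \<beta>"

lemma lookup_scale [simp]: "Poly_Mapping.lookup (pm_scale smul c f) q = smul c (Poly_Mapping.lookup f q)"
  by (rule lookup_pm_scale) (rule vector_space_axioms)

sublocale T: complex_space "pm_scale smul :: complex \<Rightarrow> ('n, 'v) tensor_A \<Rightarrow> ('n, 'v) tensor_A"
  unfolding complex_space_def by (rule vector_space_pm_scale) (rule vector_space_axioms)

lemma lookup_F_h: "Poly_Mapping.lookup (Fh r f) q = fibre_op (cvec r) (cvec (q - r) + \<alpha>) (Poly_Mapping.lookup f (q - r))"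
proof -
  have "Poly_Mapping.lookup (Fh r f) q =
      (\<Sum>s\<in>Poly_Mapping.keys f. if s = q - r then fibre_op (cvec r) (cvec s + \<alpha>) (Poly_Mapping.lookup f s) else 0)"
    unfolding F_h_def Let_def lookup_sum
    by (rule sum.cong) (auto simp: lookup_single when_def fibre_op_def cvec_bar act_X omega_def)
  also have "\<dots> = fibre_op (cvec r) (cvec (q - r) + \<alpha>) (Poly_Mapping.lookup f (q - r))"
    by (cases "q - r \<in> Poly_Mapping.keys f") (auto simp: in_keys_iff)
  finally show ?thesis .
qed

lemma lookup_F_d: "Poly_Mapping.lookup (Fd i f) q = smul (of_int (q $ i) + \<beta> $ i) (Poly_Mapping.lookup f q)"
proof -
  have "Poly_Mapping.lookup (Fd i f) q =
      (\<Sum>s\<in>Poly_Mapping.keys f. if s = q then smul (of_int (s $ i) + \<beta> $ i) (Poly_Mapping.lookup f s) else 0)"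
    unfolding F_d_def lookup_sum by (rule sum.cong) (auto simp: lookup_single when_def)
  also have "\<dots> = smul (of_int (q $ i) + \<beta> $ i) (Poly_Mapping.lookup f q)"
    by (cases "q \<in> Poly_Mapping.keys f") (auto simp: in_keys_iff)
  finally show ?thesis .
qed

lemma F_h_add: "Fh r (f + g) = Fh r f + Fh r g"
  by (rule poly_mapping_eqI) (simp add: lookup_F_h lookup_add fibre_op_add)

lemma F_h_scale: "Fh r (pm_scale smul c f) = pm_scale smul c (Fh r f)"
  by (rule poly_mapping_eqI) (simp add: lookup_F_h fibre_op_scale)

lemma F_d_add: "Fd i (f + g) = Fd i f + Fd i g"
  by (rule poly_mapping_eqI) (simp add: lookup_F_d lookup_add scale_right_distrib)

lemma F_d_scale: "Fd i (pm_scale smul c f) = pm_scale smul c (Fd i f)"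
  by (rule poly_mapping_eqI) (simp add: lookup_F_d mult.commute)

lemma F_act_add_right: "Fa x (f + g) = Fa x f + Fa x g"
  by (simp add: F_act_def F_h_add F_d_add T.scale_right_distrib sum.distrib add_ac)

lemma F_act_scale_right: "Fa x (pm_scale smul c f) = pm_scale smul c (Fa x f)"
  by (simp add: F_act_def F_h_scale F_d_scale T.scale_right_distrib T.scale_sum_right mult.commute)

text \<open>The coefficient of \<open>h\<^sub>r\<close> in \<open>x\<close> when \<open>u\<close> is the value of \<open>x\<close> at \<open>r\<close>. It is meaningful only for multiples
  of \<open>bar r\<close>, which is why the action is additive in \<open>x\<close> on \<open>ham\<close> and not beyond; at \<open>r = 0\<close> the value
  \<open>0\<close> reflects that the \<open>d\<^sub>i\<close> are treated separately.\<close>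

definition h_coeff :: "int ^ ('n + 'n) \<Rightarrow> complex ^ ('n + 'n) \<Rightarrow> complex" where
  "h_coeff r u = (if r = 0 then 0 else THE c. u = c *s cvec (bar r))"

lemma h_coeff_scale [simp]: "r \<noteq> 0 \<Longrightarrow> h_coeff r (c *s cvec (bar r)) = c"
  by (simp add: h_coeff_def the_coefficient cvec_bar_eq_0_iff)

lemma h_coeff_zero [simp]: "h_coeff r 0 = 0"
proof (cases "r = 0")
  case False
  from h_coeff_scale[OF this, of 0] show ?thesis by simp
qed (simp add: h_coeff_def)

lemma F_act_eq:
  "Fa x f = (\<Sum>r\<in>Poly_Mapping.keys x. pm_scale smul (h_coeff r (Poly_Mapping.lookup x r)) (Fh r f)) +
    (\<Sum>i\<in>UNIV. pm_scale smul (Poly_Mapping.lookup x 0 $ i) (Fd i f))"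
proof -
  have "(\<Sum>r\<in>Poly_Mapping.keys x. pm_scale smul (h_coeff r (Poly_Mapping.lookup x r)) (Fh r f))
      = (\<Sum>r\<in>Poly_Mapping.keys x - {0}. pm_scale smul (THE c. Poly_Mapping.lookup x r = c *s cvec (bar r)) (Fh r f))"
    by (rule sum.mono_neutral_cong_right) (auto simp: h_coeff_def)
  then show ?thesis by (simp add: F_act_def)
qed

lemma F_act_add_left:
  assumes "x \<in> ham" "y \<in> ham"
  shows "Fa (x + y) f = Fa x f + Fa y f"
proof -
  have "pm_scale smul (h_coeff r (Poly_Mapping.lookup x r + Poly_Mapping.lookup y r)) (Fh r f)
      = pm_scale smul (h_coeff r (Poly_Mapping.lookup x r)) (Fh r f)
      + pm_scale smul (h_coeff r (Poly_Mapping.lookup y r)) (Fh r f)" for r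
  proof (cases "r = 0")
    case False
    with assms obtain a b where ab: "Poly_Mapping.lookup x r = a *s cvec (bar r)"
      "Poly_Mapping.lookup y r = b *s cvec (bar r)" by (metis ham_lookup)
    show ?thesis
      unfolding ab vec.scale_left_distrib[symmetric] h_coeff_scale[OF False] by (rule T.scale_left_distrib)
  qed (simp add: h_coeff_def)
  then have "(\<Sum>r\<in>Poly_Mapping.keys (x + y). pm_scale smul (h_coeff r (Poly_Mapping.lookup (x + y) r)) (Fh r f))
      = (\<Sum>r\<in>Poly_Mapping.keys x. pm_scale smul (h_coeff r (Poly_Mapping.lookup x r)) (Fh r f))
      + (\<Sum>r\<in>Poly_Mapping.keys y. pm_scale smul (h_coeff r (Poly_Mapping.lookup y r)) (Fh r f))"
    by (intro setsum_keys_plus_distrib) auto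
  then show ?thesis
    by (simp add: F_act_eq lookup_add T.scale_left_distrib sum.distrib add_ac)
qed

lemma F_act_scale_left:
  assumes "x \<in> ham"
  shows "Fa (witt_scale c x) f = pm_scale smul c (Fa x f)"
proof -
  note l = lookup_pm_scale[OF vec.vector_space_axioms]
  have h: "h_coeff r (c *s Poly_Mapping.lookup x r) = c * h_coeff r (Poly_Mapping.lookup x r)" for r
  proof (cases "r = 0")
    case False
    with assms obtain a where "Poly_Mapping.lookup x r = a *s cvec (bar r)" by (metis ham_lookup)
    then show ?thesis using False by simp
  qed (simp add: h_coeff_def)
  have "(\<Sum>r\<in>Poly_Mapping.keys (witt_scale c x). pm_scale smul (h_coeff r (Poly_Mapping.lookup (witt_scale c x) r)) (Fh r f))
      = (\<Sum>r\<in>Poly_Mapping.keys x. pm_scale smul (c * h_coeff r (Poly_Mapping.lookup x r)) (Fh r f))"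
    by (rule sum.mono_neutral_cong_left) (auto simp: l h in_keys_iff)
  then show ?thesis
    by (simp add: F_act_eq l T.scale_right_distrib T.scale_sum_right)
qed

lemma F_act_h: "Fa (ham_h r) f = Fh r f"
proof (cases "r = 0")
  case True
  have "Fh 0 f = 0" by (rule poly_mapping_eqI) (simp add: lookup_F_h cvec_def zero_vec_def[symmetric])
  then show ?thesis using True by (simp add: ham_h_0 F_act_def)
qed (simp add: F_act_ham_h[OF vector_space_axioms])

lemma F_act_d: "Fa (ham_d i) f = Fd i f"
  by (rule F_act_ham_d[OF vector_space_axioms])

text \<open>The module law for the pair \<open>x\<close>, \<open>y\<close>, bundled with the memberships that make the action additive,
  so that it can be extended from generators to the span in each argument.\<close>

definition act_compatible :: "('n + 'n) witt \<Rightarrow> ('n + 'n) witt \<Rightarrow> bool" where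
  "act_compatible x y \<longleftrightarrow> x \<in> ham \<and> y \<in> ham \<and> witt_bracket x y \<in> ham \<and>
    (\<forall>f. Fa (witt_bracket x y) f = Fa x (Fa y f) - Fa y (Fa x f))"

lemma act_compatible_skew: "act_compatible x y \<Longrightarrow> act_compatible y x"
proof -
  interpret W: vector_space "witt_scale :: complex \<Rightarrow> ('n + 'n) witt \<Rightarrow> ('n + 'n) witt"
    by (rule vector_space_pm_scale[OF vec.vector_space_axioms])
  assume *: "act_compatible x y"
  have eq: "witt_bracket y x = witt_scale (-1) (witt_bracket x y)"
    by (subst witt_bracket_skew) (simp add: W.scale_minus_left)
  show "act_compatible y x"
    using * unfolding act_compatible_def eq by (simp add: F_act_scale_left ham_closed(4) del: W.scale_minus_left)
qed

lemma act_compatible_generators: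
  assumes "x \<in> {ham_h r |r. r \<noteq> 0} \<union> range ham_d" "y \<in> {ham_h r |r. r \<noteq> 0} \<union> range ham_d"
  shows "act_compatible x y"
proof -
  have hh: "act_compatible (ham_h r) (ham_h s)" for r s
  proof -
    have "pm_scale smul (omega (cvec r) (cvec s)) (Fh (r + s) f) = Fh r (Fh s f) - Fh s (Fh r f)" for f
    proof (rule poly_mapping_eqI)
      fix q
      define p where "p = q - r - s"
      have q: "q - r = p + s" "q - s = p + r" "q - (r + s) = p" "p + s - s = p" "p + r - r = p"
        by (simp_all add: p_def)
      show "Poly_Mapping.lookup (pm_scale smul (omega (cvec r) (cvec s)) (Fh (r + s) f)) q
          = Poly_Mapping.lookup (Fh r (Fh s f) - Fh s (Fh r f)) q"
        using fibre_op_commutator[of "cvec r" "cvec p + \<alpha>" "cvec s" "Poly_Mapping.lookup f p"]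
        by (simp add: lookup_F_h lookup_minus q cvec_add add_ac)
    qed
    then show ?thesis
      by (simp add: act_compatible_def ham_closed witt_bracket_ham_h F_act_scale_left F_act_h
          cvec_bar flip: omega_def)
  qed
  have dh: "act_compatible (ham_d i) (ham_h r)" for i r
  proof -
    have "pm_scale smul (of_int (r $ i)) (Fh r f) = Fd i (Fh r f) - Fh r (Fd i f)" for f
      by (rule poly_mapping_eqI)
        (simp add: lookup_F_h lookup_F_d lookup_minus fibre_op_scale flip: scale_left_diff_distrib)
    then show ?thesis
      by (simp add: act_compatible_def ham_closed witt_bracket_ham_d_h F_act_scale_left F_act_h F_act_d)
  qed
  have dd: "act_compatible (ham_d i) (ham_d j)" for i j
  proof -
    have "Fd i (Fd j f) = Fd j (Fd i f)" for f
      by (rule poly_mapping_eqI) (simp add: lookup_F_d mult.commute)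
    then show ?thesis
      by (simp add: act_compatible_def ham_closed witt_bracket_ham_d_d F_act_d) (simp add: F_act_def)
  qed
  show ?thesis using assms hh dh dd act_compatible_skew[OF dh] by auto
qed

lemma act_compatible_linear:
  assumes "act_compatible x z" "act_compatible y z"
  shows "act_compatible (witt_scale c x + y) z"
proof -
  show ?thesis
    using assms
    by (simp add: act_compatible_def witt_bracket_add_left witt_bracket_scale_left ham_closed F_act_add_left
        F_act_scale_left F_act_add_right F_act_scale_right T.scale_right_diff_distrib)
qed

lemma act_compatible_ham:
  assumes "x \<in> ham" "y \<in> ham"
  shows "act_compatible x y"
proof -
  interpret W: vector_space "witt_scale :: complex \<Rightarrow> ('n + 'n) witt \<Rightarrow> ('n + 'n) witt"
    by (rule vector_space_pm_scale[OF vec.vector_space_axioms])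
  have zero: "act_compatible 0 z" if "z \<in> ham" for z
  proof -
    have [simp]: "Fa 0 f = 0" for f by (simp add: F_act_def)
    have [simp]: "Fa z 0 = 0" using F_act_scale_right[of z 0 0] by simp
    from that show ?thesis by (simp add: act_compatible_def witt_bracket_def ham_closed)
  qed
  have gen: "act_compatible x y" if y: "y \<in> {ham_h r |r. r \<noteq> 0} \<union> range ham_d" for y
    using assms(1)[unfolded ham_def]
  proof (induction rule: W.span_induct_alt)
    case base
    show ?case using y ham_closed by (intro zero) auto
  next
    case (step c x' z)
    then show ?case using act_compatible_generators[OF step(1) y] act_compatible_linear by blast
  qed
  have "act_compatible y x"
    using assms(2)[unfolded ham_def]
  proof (induction rule: W.span_induct_alt)
    case base
    show ?case using assms(1) by (rule zero)
  next
    case (step c x' z)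
    then show ?case using act_compatible_skew[OF gen[OF step(1)]] act_compatible_linear by blast
  qed
  then show ?thesis by (rule act_compatible_skew)
qed

sublocale F: lie_module ham witt_scale witt_bracket "pm_scale smul" Fa
  using act_compatible_ham
  by unfold_locales
    (auto simp: F_act_add_right F_act_scale_right F_act_add_left F_act_scale_left act_compatible_def)

end

section \<open>Submodules of the Shen-Larsson module\<close>

text \<open>The composition of \<open>h\<^sub>t\<^sub>p\<close> and \<open>h\<^sub>r\<^sub>-\<^sub>t\<^sub>p\<close> as a polynomial in \<open>t\<close>. The leading coefficient is \<open>X\<^sub>p\<^sup>2\<close>, and for
  a trivial \<open>sp\<^sub>N\<close>-action the quadratic one is the scalar \<open>-\<omega>(p, w + r) \<omega>(p, w)\<close>.\<close>

lemma (in sp_module) fibre_op_twice: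
  "fibre_op (r - t *s p) (w + t *s p) (fibre_op (t *s p) w v) = 0
    + smul t (smul (omega r w * omega p w) v + smul (omega p w / 2) (sg r r v))
    + smul (t ^ 2) (smul ((omega r p - omega p w) * omega p w) v + smul (omega r w / 2) (sg p p v)
        + smul (1 / 4) (sg r r (sg p p v)) - smul (omega p w) (sg r p v))
    + smul (t ^ 3) (smul ((omega r p - omega p w) / 2) (sg p p v) - smul (1 / 2) (sg r p (sg p p v))
        + smul (omega p w / 2) (sg p p v))
    + smul (t ^ 4) (smul (1 / 4) (sg p p (sg p p v)))"
proof -
  have 1: "fibre_op (t *s p) w v = smul (t * omega p w) v + smul (t ^ 2 / 2) (sg p p v)"
    by (simp add: fibre_op_def power2_eq_square)
  have sq: "sg (r - t *s p) (r - t *s p) u = sg r r u - smul (2 * t) (sg r p u) + smul (t ^ 2) (sg p p u)" for u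
  proof -
    have "sg (r - t *s p) (r - t *s p) u = sg r r u - (smul t (sg r p u) + smul t (sg r p u)) + smul (t ^ 2) (sg p p u)"
      by (simp add: sg_commute[of p r] scale_right_diff_distrib power2_eq_square)
    also have "smul t (sg r p u) + smul t (sg r p u) = smul (2 * t) (sg r p u)"
      unfolding double by simp
    finally show ?thesis .
  qed
  have 2: "fibre_op (r - t *s p) (w + t *s p) u = smul (omega r w + t * (omega r p - omega p w)) u
      + smul (1 / 2) (sg r r u) - smul t (sg r p u) + smul (t ^ 2 / 2) (sg p p u)" for u
    unfolding fibre_op_def sq by (simp add: scale_right_distrib scale_right_diff_distrib algebra_simps)
  show ?thesis
    unfolding 1 2
    by (simp add: scale_right_distrib scale_right_diff_distrib scale_left_distrib scale_left_diff_distrib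
        diff_divide_distrib add_divide_distrib power2_eq_square power3_eq_cube power4_eq_xxxx algebra_simps)
qed

context shen_larsson
begin

definition fibre :: "('n, 'v) tensor_A set \<Rightarrow> int ^ ('n + 'n) \<Rightarrow> 'v set" where
  "fibre M s = {v. Poly_Mapping.single s v \<in> M}"

lemma scale_single: "pm_scale smul c (Poly_Mapping.single s v) = Poly_Mapping.single s (smul c v)"
  by (rule poly_mapping_eqI) (simp add: lookup_single when_def)

lemma sum_singles: "(\<Sum>s\<in>Poly_Mapping.keys f. Poly_Mapping.single s (Poly_Mapping.lookup f s)) = f"
  by (rule poly_mapping_eqI) (simp add: lookup_sum lookup_single when_def in_keys_iff sum.delta cong: if_cong)

lemma subspace_fibre:
  assumes "F.submodule M"
  shows "subspace (fibre M s)"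
proof -
  have M: "T.subspace M" using assms by (simp add: F.submodule_def)
  show ?thesis
    using T.subspace_0[OF M] T.subspace_add[OF M] T.subspace_scale[OF M]
    by (auto simp: subspace_def fibre_def single_add simp flip: scale_single)
qed

lemma fibre_op_mem_fibre:
  assumes M: "F.submodule M" and v: "v \<in> fibre M s"
  shows "fibre_op (cvec r) (cvec s + \<alpha>) v \<in> fibre M (r + s)"
proof -
  have "Fh r (Poly_Mapping.single s v) \<in> M"
    using M v ham_closed(1)[of r] unfolding F.submodule_def fibre_def by (metis F_act_h mem_Collect_eq)
  also have "Fh r (Poly_Mapping.single s v) = Poly_Mapping.single (r + s) (fibre_op (cvec r) (cvec s + \<alpha>) v)"
    by (rule poly_mapping_eqI) (auto simp: lookup_F_h lookup_single when_def)
  finally show ?thesis by (simp add: fibre_def)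
qed

text \<open>Submodules are graded, because the \<open>d\<^sub>i\<close> act on distinct fibres by distinct families of scalars.\<close>

lemma mem_submodule_iff:
  assumes M: "F.submodule M"
  shows "f \<in> M \<longleftrightarrow> (\<forall>s. Poly_Mapping.lookup f s \<in> fibre M s)"
proof
  have sub: "T.subspace M" using M by (simp add: F.submodule_def)
  show "f \<in> M" if "\<forall>s. Poly_Mapping.lookup f s \<in> fibre M s"
    using that T.subspace_sum[OF sub, of "Poly_Mapping.keys f" "\<lambda>s. Poly_Mapping.single s (Poly_Mapping.lookup f s)"]
    by (simp add: sum_singles fibre_def)
  assume f: "f \<in> M"
  show "\<forall>s. Poly_Mapping.lookup f s \<in> fibre M s"
  proof
    fix s
    show "Poly_Mapping.lookup f s \<in> fibre M s"
    proof (cases "s \<in> Poly_Mapping.keys f")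
      case False
      then show ?thesis using subspace_0[OF subspace_fibre[OF M]] by (simp add: in_keys_iff)
    next
      case True
      have "Poly_Mapping.single s (Poly_Mapping.lookup f s) \<in> M"
      proof (rule T.eigenvectors_in_invariant_subspace[where H = Fd and A = "Poly_Mapping.keys f"
            and u = "\<lambda>j. Poly_Mapping.single j (Poly_Mapping.lookup f j)"
            and l = "\<lambda>j i. of_int (j $ i) + \<beta> $ i"])
        show "Fd i u \<in> M" if "u \<in> M" for i u
          using M that ham_closed(2)[of i] unfolding F.submodule_def by (metis F_act_d)
        show "Fd i (Poly_Mapping.single j (Poly_Mapping.lookup f j)) =
          pm_scale smul (of_int (j $ i) + \<beta> $ i) (Poly_Mapping.single j (Poly_Mapping.lookup f j))" for i j
          by (rule poly_mapping_eqI) (simp add: lookup_F_d lookup_single when_def)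
        show "inj_on (\<lambda>j i. of_int (j $ i) + \<beta> $ i) (Poly_Mapping.keys f)"
          by (auto simp: inj_on_def fun_eq_iff vec_eq_iff)
      qed (use True f sub in \<open>auto simp: sum_singles F_d_add F_d_scale\<close>)
      then show ?thesis by (simp add: fibre_def)
    qed
  qed
qed

text \<open>The path from the fibre over \<open>s\<close> through the one over \<open>s + m p\<close> ends over \<open>q\<close> for every \<open>m\<close>, so each
  coefficient of the polynomial \<open>fibre_op_twice\<close> maps the fibre over \<open>s\<close> into the one over \<open>q\<close>.\<close>

lemma double_step:
  fixes q
  assumes M: "F.submodule M" and v: "v \<in> fibre M s"
  defines "w \<equiv> cvec s + \<alpha>" and "r \<equiv> cvec (q - s)"
  shows "smul ((omega r (cvec p) - omega (cvec p) w) * omega (cvec p) w) v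
        + smul (omega r w / 2) (sg (cvec p) (cvec p) v)
        + smul (1 / 4) (sg r r (sg (cvec p) (cvec p) v)) - smul (omega (cvec p) w) (sg r (cvec p) v) \<in> fibre M q"
    and "sg (cvec p) (cvec p) (sg (cvec p) (cvec p) v) \<in> fibre M q"
proof -
  have "fibre_op (r - of_nat m *s cvec p) (w + of_nat m *s cvec p) (fibre_op (of_nat m *s cvec p) w v) \<in> fibre M q" for m :: nat
    using fibre_op_mem_fibre[OF M fibre_op_mem_fibre[OF M v, of "of_nat m *s p"], of "q - s - of_nat m *s p"]
    by (simp add: cvec_of_nat_scale cvec_diff cvec_add w_def r_def add_ac)
  note * = quartic_coefficients_in_subspace[OF subspace_fibre[OF M, of q] this[unfolded fibre_op_twice]]
  show "smul ((omega r (cvec p) - omega (cvec p) w) * omega (cvec p) w) v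
        + smul (omega r w / 2) (sg (cvec p) (cvec p) v)
        + smul (1 / 4) (sg r r (sg (cvec p) (cvec p) v)) - smul (omega (cvec p) w) (sg r (cvec p) v) \<in> fibre M q"
    by (rule *(3))
  from subspace_scale[OF subspace_fibre[OF M] *(5), of 4]
  show "sg (cvec p) (cvec p) (sg (cvec p) (cvec p) v) \<in> fibre M q" by simp
qed

text \<open>The vector \<open>v\<close> can be taken in the fibre over \<open>q - m p\<close>, from which \<open>h\<^sub>m\<^sub>p\<close> leads to the fixed fibre over
  \<open>q\<close>. There it acts as \<open>m \<omega>(p, q + \<alpha>) + m\<^sup>2 X\<^sub>p\<close>, and the second coefficient is as claimed up to
  polarization.\<close>

lemma sg_fibres:
  assumes M: "F.submodule M" and v: "\<And>s. v \<in> fibre M s"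
  shows "sg (unit_vec a) (unit_vec b) v \<in> fibre M q"
proof -
  note sub = subspace_fibre[OF M, of q]
  have sq: "sg (cvec p) (cvec p) v \<in> fibre M q" for p
  proof -
    have "0 + smul (of_nat m) (smul (omega (cvec p) (cvec q + \<alpha>)) v)
        + smul (of_nat m ^ 2) (smul (1 / 2) (sg (cvec p) (cvec p) v))
        + smul (of_nat m ^ 3) 0 + smul (of_nat m ^ 4) 0 \<in> fibre M q" for m :: nat
      using fibre_op_mem_fibre[OF M v, of "of_nat m *s p" "q - of_nat m *s p"]
      by (simp add: cvec_of_nat_scale cvec_diff fibre_op_def power2_eq_square mult.commute algebra_simps)
    from quartic_coefficients_in_subspace(3)[OF sub this] have "smul (1 / 2) (sg (cvec p) (cvec p) v) \<in> fibre M q" .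
    from subspace_scale[OF sub this, of 2] show ?thesis by simp
  qed
  have "smul (1 / 2) (sg (cvec (axis a 1 + axis b 1)) (cvec (axis a 1 + axis b 1)) v
      - sg (cvec (axis a 1)) (cvec (axis a 1)) v - sg (cvec (axis b 1)) (cvec (axis b 1)) v) \<in> fibre M q"
    by (intro subspace_scale[OF sub] subspace_diff[OF sub] sq)
  then show ?thesis
    unfolding sg_polarization[of "unit_vec a" "unit_vec b" v] by (simp only: cvec_add cvec_axis)
qed

lemma F_irreducibleI:
  assumes nz: "\<exists>v::'v. v \<noteq> 0"
    and all: "\<And>M s v q u. F.submodule M \<Longrightarrow> v \<in> fibre M s \<Longrightarrow> v \<noteq> 0 \<Longrightarrow> u \<in> fibre M q"
  shows "F_irreducible smul act \<alpha> \<beta>"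
  unfolding F_irreducible_def
proof (unfold_locales)
  from nz obtain v :: 'v where "v \<noteq> 0" by blast
  then have "Poly_Mapping.lookup (Poly_Mapping.single 0 v) (0 :: int ^ ('n + 'n)) \<noteq> 0" by simp
  then show "\<exists>f :: ('n, 'v) tensor_A. f \<noteq> 0" by (metis lookup_zero)
next
  fix M assume M: "F.submodule M"
  then have "0 \<in> M" by (auto simp: F.submodule_def T.subspace_0)
  show "M = {0} \<or> M = UNIV"
  proof (cases "M \<subseteq> {0}")
    case False
    then obtain f where f: "f \<in> M" "f \<noteq> 0" by blast
    then obtain s where "Poly_Mapping.lookup f s \<noteq> 0" by (metis poly_mapping_eqI lookup_zero)
    with all[OF M] f M have "\<And>u q. u \<in> fibre M q" by (metis mem_submodule_iff)
    then show ?thesis using mem_submodule_iff[OF M] by blast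
  qed (use \<open>0 \<in> M\<close> in blast)
qed

lemma not_F_irreducibleI:
  assumes U: "\<And>q. subspace (U q)"
    and stable: "\<And>r q v. v \<in> U q \<Longrightarrow> fibre_op (cvec r) (cvec q + \<alpha>) v \<in> U (r + q)"
    and nz: "v \<in> U q" "v \<noteq> 0" and proper: "v' \<notin> U q'"
  shows "\<not> F_irreducible smul act \<alpha> \<beta>"
proof
  assume "F_irreducible smul act \<alpha> \<beta>"
  then interpret I: irreducible_lie_module ham witt_scale witt_bracket "pm_scale smul" Fa
    by (simp add: F_irreducible_def)
  define M where "M = {f. \<forall>q. Poly_Mapping.lookup f q \<in> U q}"
  have sub: "T.subspace M"
    using U by (auto simp: T.subspace_def M_def lookup_add subspace_0 subspace_add subspace_scale)
  have Fh: "Fh r f \<in> M" if "f \<in> M" for r f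
  proof -
    have "Poly_Mapping.lookup (Fh r f) q \<in> U q" for q
      using stable[of "Poly_Mapping.lookup f (q - r)" "q - r" r] that by (simp add: lookup_F_h M_def)
    then show ?thesis by (simp add: M_def)
  qed
  have Fd: "Fd i f \<in> M" if "f \<in> M" for i f
    using that U by (simp add: M_def lookup_F_d subspace_scale)
  have "F.submodule M"
    unfolding F.submodule_def
  proof (intro conjI ballI)
    fix x f assume "f \<in> M"
    then show "Fa x f \<in> M"
      unfolding F_act_eq
      by (intro T.subspace_add[OF sub] T.subspace_sum[OF sub] T.subspace_scale[OF sub] Fh Fd)
  qed (rule sub)
  with I.simple have "M = {0} \<or> M = UNIV" by blast
  moreover have "Poly_Mapping.single q v \<in> M" "Poly_Mapping.single q v \<noteq> 0"
    using nz subspace_0[OF U] by (auto simp: M_def lookup_single when_def)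
      (metis lookup_single_eq lookup_zero)
  moreover have "Poly_Mapping.single q' v' \<notin> M"
    using proper by (auto simp: M_def lookup_single when_def)
  ultimately show False by blast
qed

end

section \<open>The irreducibility criterion\<close>

locale shen_larsson_irreducible = shen_larsson smul act \<alpha> \<beta>
    + irreducible_lie_module sp mat_scale mat_bracket smul act
  for smul :: "complex \<Rightarrow> 'v::ab_group_add \<Rightarrow> 'v"
    and act :: "'n::{finite,linorder} cmat \<Rightarrow> 'v \<Rightarrow> 'v" and \<alpha> \<beta>
begin

lemma F_irreducible_if_nonzero_square:
  assumes "\<not> X_sq_zero (cvec p0) v0"
  shows "F_irreducible smul act \<alpha> \<beta>"
proof (rule F_irreducibleI[OF nonzero])
  fix M s v q u assume M: "F.submodule M" and v: "v \<in> fibre M s" "v \<noteq> 0"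
  have "submodule {v. \<forall>p\<in>range cvec. X_sq_zero p v}" (is "submodule ?K")
  proof (rule submodule_X_sq_kernel)
    show "unit_vec a \<in> range cvec" for a by (metis cvec_axis rangeI)
  qed (auto simp flip: cvec_add)
  moreover have "?K \<noteq> UNIV" using assms by auto
  ultimately have "?K = {0}" using simple by blast
  with v(2) have "v \<notin> ?K" by blast
  then obtain p where p: "sg (cvec p) (cvec p) (sg (cvec p) (cvec p) v) \<noteq> 0" by blast
  define N where "N = {v. \<forall>q. v \<in> fibre M q}"
  have "subspace N"
    using subspace_fibre[OF M] by (auto simp: N_def subspace_def)
  then have "submodule N"
    unfolding submodule_iff_sg using sg_fibres[OF M] by (auto simp: N_def)
  moreover have "sg (cvec p) (cvec p) (sg (cvec p) (cvec p) v) \<in> N"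
    using double_step(2)[OF M v(1)] by (simp add: N_def)
  ultimately have "N = UNIV" using simple p by blast
  then show "u \<in> fibre M q" by (auto simp: N_def)
qed

text \<open>The fibres of the submodule are the images \<open>X\<^sub>w V\<close> with \<open>w = s + \<alpha>\<close>. Vanishing squares give
  \<open>sg w r X\<^sub>w = \<omega>(r, w) X\<^sub>w\<close>, whence \<open>(\<omega>(r, w) + X\<^sub>r) X\<^sub>w = X\<^sub>w\<^sub>+\<^sub>r X\<^sub>w\<close>.\<close>

lemma F_reducible_if_squares_zero:
  assumes Q: "\<And>p v. X_sq_zero p v" and nontrivial: "sg (unit_vec a0) (unit_vec b0) v0 \<noteq> 0"
  shows "\<not> F_irreducible smul act \<alpha> \<beta>"
proof -
  define U where "U q = range (sg (cvec q + \<alpha>) (cvec q + \<alpha>))" for q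
  have sub: "subspace (U q)" for q
    unfolding subspace_def U_def
    by (auto simp del: sg_add_left sg_add_mid simp flip: sg_add sg_scale intro: rangeI) (metis rangeI sg_zero)
  have stable: "fibre_op (cvec r) (cvec q + \<alpha>) v \<in> U (r + q)" if v: "v \<in> U q" for r q v
  proof -
    define x where "x = cvec r"
    define w where "w = cvec q + \<alpha>"
    from v obtain u where u: "v = sg w w u" by (auto simp: U_def w_def)
    have "sg w x (sg w w u) = - sg w x (sg w w u) + smul (2 * omega x w) (sg w w u)"
    proof -
      have "sg w w (sg w x u) = - sg w x (sg w w u)"
        using polarized_X_sq(2)[of w x u] Q by (subst eq_neg_iff_add_eq_0) blast
      moreover have "sg w x (sg w w u) = sg w w (sg w x u) + smul (2 * omega x w) (sg w w u)"
        by (subst sg_swap) (simp add: sg_commute[of x w] double)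
      ultimately show ?thesis by simp
    qed
    then have "sg w x (sg w w u) = smul (omega x w) (sg w w u)" by (rule eq_smul_if_eq_minus)
    then have "fibre_op x w (sg w w u) = smul (1 / 2) (sg (w + x) (w + x) (sg w w u))"
      using Q[of w u] by (simp add: fibre_op_def sg_commute[of x w] double scale_right_distrib)
    also have "\<dots> = sg (w + x) (w + x) (smul (1 / 2) (sg w w u))" by simp
    also have "w + x = cvec (r + q) + \<alpha>" by (simp add: w_def x_def cvec_add)
    finally show ?thesis unfolding u U_def x_def w_def by (metis rangeI)
  qed
  obtain q v where qv: "sg (cvec q + \<alpha>) (cvec q + \<alpha>) v \<noteq> 0"
  proof (rule ccontr)
    assume "\<not> thesis"
    then have zero: "sg (cvec q + \<alpha>) (cvec q + \<alpha>) v = 0" for q v using that by blast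
    have sq: "sg (cvec p) (cvec p) v = 0" for p v
    proof -
      have "sg \<alpha> \<alpha> v + smul (of_nat m) (smul 2 (sg \<alpha> (cvec p) v)) + smul (of_nat m ^ 2) (sg (cvec p) (cvec p) v)
          + smul (of_nat m ^ 3) 0 + smul (of_nat m ^ 4) 0 \<in> {0}" for m :: nat
        using zero[of "of_nat m *s p" v]
        by (simp add: cvec_of_nat_scale sg_commute[of "cvec p" \<alpha>] power2_eq_square scale_right_distrib
            mult.commute algebra_simps flip: double)
      from quartic_coefficients_in_subspace(3)[OF _ this] show ?thesis by (simp add: subspace_def)
    qed
    have "sg (unit_vec a0) (unit_vec b0) v0 = 0"
      using sq[of "axis a0 1 + axis b0 1" v0] sq[of "axis a0 1" v0] sq[of "axis b0 1" v0]
      unfolding sg_polarization[of "unit_vec a0" "unit_vec b0" v0] cvec_add cvec_axis by simp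
    with nontrivial show False by blast
  qed
  have "U q \<noteq> UNIV"
  proof
    assume "U q = UNIV"
    then obtain u where "v = sg (cvec q + \<alpha>) (cvec q + \<alpha>) u" unfolding U_def by (metis UNIV_I imageE)
    with Q qv show False by metis
  qed
  then obtain v' where "v' \<notin> U q" by blast
  moreover have "sg (cvec q + \<alpha>) (cvec q + \<alpha>) v \<in> U q" unfolding U_def by (rule rangeI)
  ultimately show ?thesis using sub stable qv by (intro not_F_irreducibleI[of U])
qed

lemma span_nonzero_if_trivial:
  assumes "\<And>a b v. sg (unit_vec a) (unit_vec b) v = 0" and "v \<noteq> 0"
  shows "span {v} = UNIV"
proof -
  have "submodule (span {v})"
    using assms(1) span_zero by (simp add: submodule_iff_sg)
  with simple have "span {v} = {0} \<or> span {v} = UNIV" by blast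
  with assms(2) span_base[of v "{v}"] show ?thesis by auto
qed

lemma is_trivial_module_iff:
  "is_trivial_module smul act \<longleftrightarrow> (\<forall>a b v. sg (unit_vec a) (unit_vec b) v = 0)"
proof
  assume "is_trivial_module smul act"
  then obtain \<phi> where lin: "Vector_Spaces.linear smul (*) \<phi>" and bij: "bij \<phi>"
    and act: "\<And>x v. x \<in> sp \<Longrightarrow> \<phi> (act x v) = 0"
    unfolding is_trivial_module_def lie_module_iso_def by blast
  interpret \<phi>: Vector_Spaces.linear smul "(*)" \<phi> by (rule lin)
  show "\<forall>a b v. sg (unit_vec a) (unit_vec b) v = 0"
    using act bij \<phi>.zero unfolding sg_def by (metis symm_in_sp bij_is_inj injD)
next
  assume zero: "\<forall>a b v. sg (unit_vec a) (unit_vec b) v = 0"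
  have act0: "act x v = 0" if "x \<in> sp" for x v
    using act_in_subspace[of "{0}" v x] that zero by (simp add: subspace_def)
  from nonzero obtain v :: 'v where v: "v \<noteq> 0" by blast
  define g where "g c = smul c v" for c
  have "range g = span {v}" by (auto simp: g_def span_singleton)
  also have "\<dots> = UNIV" by (rule span_nonzero_if_trivial) (use zero v in auto)
  finally have "bij g" using v by (auto simp: bij_def g_def inj_def)
  then have g: "inv g (g c) = c" "g (inv g u) = u" for c u
    by (simp_all add: bij_is_inj bij_is_surj surj_f_inv_f)
  have add: "inv g (a + b) = inv g a + inv g b" for a b
  proof -
    have "g (inv g a + inv g b) = g (inv g a) + g (inv g b)" unfolding g_def by (rule scale_left_distrib)
    then have "a + b = g (inv g a + inv g b)" by (simp add: g)
    then show ?thesis by (simp add: g)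
  qed
  have scale: "inv g (smul c a) = c * inv g a" for a c
  proof -
    have "smul c a = g (c * inv g a)" using g(2)[of a] by (simp add: g_def flip: scale_scale)
    then show ?thesis by (simp add: g)
  qed
  interpret C: vector_space "(*) :: complex \<Rightarrow> complex \<Rightarrow> complex"
    by unfold_locales (simp_all add: algebra_simps)
  have "Vector_Spaces.linear smul (*) (inv g)"
    by unfold_locales (simp_all add: add scale)
  moreover have "inv g (act x u) = 0" if "x \<in> sp" for x u
    using scale[of 0 0] by (simp add: act0[OF that])
  ultimately show "is_trivial_module smul act"
    using \<open>bij g\<close> unfolding is_trivial_module_def lie_module_iso_def by (blast intro: bij_imp_bij_inv)
qed

lemma omega_nondegenerate:
  assumes "w \<noteq> 0"
  obtains a where "omega (unit_vec a) w \<noteq> 0"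
proof -
  from assms obtain i where i: "w $ i \<noteq> 0" by (auto simp: vec_eq_iff)
  show ?thesis
    by (cases i) (use i that[of "Inr _"] that[of "Inl _"] in \<open>auto simp: omega_unit_vec\<close>)
qed

lemma omega_separate:
  assumes "w \<noteq> 0" "w' \<noteq> 0"
  obtains p where "omega (cvec p) w \<noteq> 0" "omega (cvec p) w' \<noteq> 0"
proof -
  from assms obtain a b where a: "omega (unit_vec a) w \<noteq> 0" and b: "omega (unit_vec b) w' \<noteq> 0"
    by (metis omega_nondegenerate)
  consider "omega (unit_vec a) w' \<noteq> 0" | "omega (unit_vec b) w \<noteq> 0"
    | "omega (unit_vec a) w' = 0" "omega (unit_vec b) w = 0" by blast
  then show ?thesis
  proof cases
    case 1
    then show ?thesis using a that[of "axis a 1"] by (simp add: cvec_axis)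
  next
    case 2
    then show ?thesis using b that[of "axis b 1"] by (simp add: cvec_axis)
  next
    case 3
    then show ?thesis using a b that[of "axis a 1 + axis b 1"] by (simp add: cvec_axis cvec_add)
  qed
qed

text \<open>For \<open>\<alpha> = a\<close> integral, every \<open>h\<^sub>r\<close> kills the fibre over \<open>-a\<close>. Otherwise the quadratic coefficient
  \<open>-\<omega>(p, q + \<alpha>) \<omega>(p, s + \<alpha>)\<close> of \<open>fibre_op_twice\<close> connects the fibres over \<open>s\<close> and \<open>q\<close> for a suitable \<open>p\<close>.\<close>

lemma F_irreducible_trivial_iff:
  assumes zero: "\<And>a b v. sg (unit_vec a) (unit_vec b) v = 0"
  shows "F_irreducible smul act \<alpha> \<beta> \<longleftrightarrow> \<alpha> \<notin> range cvec"
proof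
  have "act x v = 0" if "x \<in> sp" for x v
    using act_in_subspace[of "{0}" v x] that zero by (simp add: subspace_def)
  then have zero': "sg u w v = 0" for u w v by (simp add: sg_def symm_in_sp)
  then have fibre_op: "fibre_op r w v = smul (omega r w) v" for r w v by (simp add: fibre_op_def)
  show "F_irreducible smul act \<alpha> \<beta>" if \<alpha>: "\<alpha> \<notin> range cvec"
  proof (rule F_irreducibleI[OF nonzero])
    fix M s v q u assume M: "F.submodule M" and v: "v \<in> fibre M s" "v \<noteq> 0"
    have nz: "cvec s + \<alpha> \<noteq> 0" for s
    proof
      assume "cvec s + \<alpha> = 0"
      then have "\<alpha> = cvec (- s)" by (simp add: cvec_def vec_eq_iff add_eq_0_iff)
      with \<alpha> show False by blast
    qed
    obtain p where p: "omega (cvec p) (cvec s + \<alpha>) \<noteq> 0" "omega (cvec p) (cvec q + \<alpha>) \<noteq> 0"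
      using omega_separate[OF nz nz] by blast
    have eq: "omega (cvec (q - s)) (cvec p) - omega (cvec p) (cvec s + \<alpha>) = - omega (cvec p) (cvec q + \<alpha>)"
      using omega_skew[of "cvec p" "cvec q"] omega_skew[of "cvec p" "cvec s"] by (simp add: cvec_diff)
    have in_fibre: "smul (- omega (cvec p) (cvec q + \<alpha>) * omega (cvec p) (cvec s + \<alpha>)) v \<in> fibre M q"
      using double_step(1)[OF M v(1), of q p]
      by (simp only: eq zero' scale_zero_right add_0_right diff_zero)
    have c: "- omega (cvec p) (cvec q + \<alpha>) * omega (cvec p) (cvec s + \<alpha>) \<noteq> 0" (is "?c \<noteq> 0")
      using p by (simp del: omega_simps)
    have "smul (inverse ?c) (smul ?c v) \<in> fibre M q"
      by (rule subspace_scale[OF subspace_fibre[OF M] in_fibre])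
    then have "v \<in> fibre M q" unfolding scale_scale left_inverse[OF c] by simp
    then have "span {v} \<subseteq> fibre M q"
      by (intro span_minimal subspace_fibre[OF M]) auto
    then show "u \<in> fibre M q" using span_nonzero_if_trivial[OF zero v(2)] by blast
  qed
  show "\<alpha> \<notin> range cvec" if "F_irreducible smul act \<alpha> \<beta>"
  proof
    assume "\<alpha> \<in> range cvec"
    then obtain a where a: "\<alpha> = cvec a" by blast
    from nonzero obtain v :: 'v where v: "v \<noteq> 0" by blast
    have "\<not> F_irreducible smul act \<alpha> \<beta>"
    proof (rule not_F_irreducibleI)
      define U where "U q = (if q = - a then UNIV else {0 :: 'v})" for q
      show "subspace (U q)" for q by (simp add: U_def subspace_def)
      show "fibre_op (cvec r) (cvec q + \<alpha>) u \<in> U (r + q)" if "u \<in> U q" for r q u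
        using that by (auto simp: U_def fibre_op a cvec_def vec_eq_iff omega_def pair_def split: if_splits)
      show "v \<in> U (- a)" by (simp add: U_def)
      show "v \<notin> U (- a + axis undefined 1)" using v by (simp add: U_def axis_eq_0_iff)
    qed (rule v)
    with that show False by blast
  qed
qed

end

theorem mainTheorem1:
  fixes smul :: "complex \<Rightarrow> 'v::ab_group_add \<Rightarrow> 'v"
    and act :: "'n::{finite,linorder} cmat \<Rightarrow> 'v \<Rightarrow> 'v"
    and \<alpha> \<beta> :: "complex ^ ('n + 'n)"
  assumes "irreducible_sp_module smul act"
  shows "F_irreducible smul act \<alpha> \<beta> \<longleftrightarrow>
      \<not> finite_dim smul
    \<or> (finite_dim smul \<and> (\<forall>k\<le>CARD('n). \<not> is_V_delta k smul act))
    \<or> (is_trivial_module smul act \<and> \<alpha> \<notin> range cvec)"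
proof -
  interpret irreducible_lie_module sp mat_scale mat_bracket smul act by fact
  interpret shen_larsson_irreducible smul act \<alpha> \<beta> by unfold_locales
  show ?thesis
  proof (cases "\<forall>p v. X_sq_zero (cvec p) v")
    case False
    then have "F_irreducible smul act \<alpha> \<beta>" using F_irreducible_if_nonzero_square by blast
    moreover have "\<not> is_V_delta k smul act" if "k \<le> CARD('n)" for k
      using False X_sq_zero_of_V_delta that by blast
    ultimately show ?thesis by blast
  next
    case True
    interpret square_zero_module smul act by unfold_locales (use True in blast)
    from fundamental obtain k where k: "k \<le> CARD('n)" "is_V_delta k smul act" by blast
    have Q: "X_sq_zero p v" for p v by (rule X_sq_zero_of_V_delta[OF k(2,1)])
    have fin: "finite_dim smul" using k(2) by (simp add: is_V_delta_def)
    have "F_irreducible smul act \<alpha> \<beta> \<longleftrightarrow> is_trivial_module smul act \<and> \<alpha> \<notin> range cvec"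
    proof (cases "is_trivial_module smul act")
      case True
      then show ?thesis using F_irreducible_trivial_iff is_trivial_module_iff by blast
    next
      case False
      then show ?thesis using F_reducible_if_squares_zero[OF Q] is_trivial_module_iff by blast
    qed
    with k fin show ?thesis by blast
  qed
qed

end
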